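(* Let $\mathcal{F}$ be an $(\alpha,\beta)$-smooth family of bipartite graphs with relative density $\rho$, where $2>\alpha>\beta\ge 1$. Then there exists $k_0$ such that for all odd $k\ge k_0$ and all sufficiently large $n$ the following holds: if $G$ is an $n$-vertex $\mathcal{F}\cup\{C_k\}$-free graph with minimum degree at least $\rho\big(\tfrac{2n}{5}+o(n)\big)^{\alpha-1}$, then $G$ is bipartite.
   Context: A graph is $\mathcal{H}$-free if it contains no member of the family $\mathcal{H}$ as a (not necessarily induced) subgraph. $C_k$ denotes the cycle of length $k$. For a family $\mathcal{F}$ of bipartite graphs, $z(m,n,\mathcal{F})$ denotes the maximum number of edges in an $\mathcal{F}$-free bipartite graph with parts of sizes $m$ and $n$. For reals $1\le\beta<\alpha<2$, $\mathcal{F}$ is $(\alpha,\beta)$-smooth with relative density $\rho\ge 0$ if for all $m\le n$, $z(m,n,\mathcal{F})=\rho m n^{\alpha-1}+O(n^{\beta})$ (asymptotics as $n\to\infty$, uniformly in $m\le n$).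
   Formalization: The relative density ρ is assumed positive; for ρ = 0 the claim is false: the family {2K₂} is (3/2,1)-smooth with ρ = 0, and a triangle plus isolated vertices is {2K₂, C_k}-free for k ≥ 4, meets the vacuous degree condition and is not bipartite. *)

theory Defs
  imports Complex_Main "HOL-Library.Landau_Symbols"
begin

type_synonym 'a graph = "'a set \<times> 'a set set"

abbreviation verts :: "'a graph \<Rightarrow> 'a set" where "verts \<equiv> fst"

abbreviation edges :: "'a graph \<Rightarrow> 'a set set" where "edges \<equiv> snd"

definition simple_graph :: "'a graph \<Rightarrow> bool" where
  "simple_graph G \<longleftrightarrow> finite (verts G) \<and> edges G \<subseteq> {e. e \<subseteq> verts G \<and> card e = 2}"

definition degree :: "'a graph \<Rightarrow> 'a \<Rightarrow> nat" where
  "degree G v = card {e \<in> edges G. v \<in> e}"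

definition min_degree :: "'a graph \<Rightarrow> nat" where
  "min_degree G = Min (degree G ` verts G)"

text \<open>\<open>H\<close> occurs as a not necessarily induced subgraph of \<open>G\<close>, up to isomorphism.\<close>

definition contains_copy :: "'a graph \<Rightarrow> 'b graph \<Rightarrow> bool" where
  "contains_copy G H \<longleftrightarrow>
     (\<exists>f. inj_on f (verts H) \<and> f ` verts H \<subseteq> verts G \<and> (\<forall>e\<in>edges H. f ` e \<in> edges G))"

definition family_free :: "'b graph set \<Rightarrow> 'a graph \<Rightarrow> bool" where
  "family_free \<F> G \<longleftrightarrow> (\<forall>H\<in>\<F>. \<not> contains_copy G H)"

text \<open>For \<open>k \<ge> 3\<close> this is a cycle of length \<open>k\<close>; smaller \<open>k\<close> are not meaningful.\<close>

definition cycle_graph :: "nat \<Rightarrow> nat graph" where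
  "cycle_graph k = ({..<k}, {{i, Suc i mod k} | i. i < k})"

definition bipartite_with :: "'a graph \<Rightarrow> 'a set \<Rightarrow> 'a set \<Rightarrow> bool" where
  "bipartite_with G X Y \<longleftrightarrow> verts G = X \<union> Y \<and> X \<inter> Y = {} \<and>
     (\<forall>e\<in>edges G. \<exists>x\<in>X. \<exists>y\<in>Y. e = {x, y})"

definition bipartite :: "'a graph \<Rightarrow> bool" where
  "bipartite G \<longleftrightarrow> (\<exists>X Y. bipartite_with G X Y)"

definition bipartite_family :: "'a graph set \<Rightarrow> bool" where
  "bipartite_family \<F> \<longleftrightarrow> (\<forall>H\<in>\<F>. simple_graph H \<and> bipartite H)"

text \<open>
  Finite graphs are represented, up to isomorphism, on vertex sets of natural numbers.
  If some member of \<open>\<F>\<close> has no edges, there may be no \<open>\<F>\<close>-free graph with parts of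
  sizes \<open>m\<close> and \<open>n\<close>; the value is then the unspecified \<open>Max {}\<close>.
\<close>

definition zarankiewicz :: "nat \<Rightarrow> nat \<Rightarrow> nat graph set \<Rightarrow> nat" where
  "zarankiewicz m n \<F> = Max {card (edges G) | G :: nat graph.
     simple_graph G \<and> family_free \<F> G \<and>
     (\<exists>X Y. bipartite_with G X Y \<and> card X = m \<and> card Y = n)}"

text \<open>The error term is uniform in \<open>m \<le> n\<close>; relative density \<open>\<rho> = 0\<close> is permitted.\<close>

definition smooth :: "real \<Rightarrow> real \<Rightarrow> real \<Rightarrow> nat graph set \<Rightarrow> bool" where
  "smooth \<alpha> \<beta> \<rho> \<F> \<longleftrightarrow> 1 \<le> \<beta> \<and> \<beta> < \<alpha> \<and> \<alpha> < 2 \<and> 0 \<le> \<rho> \<and>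
     (\<exists>C N. \<forall>n\<ge>N. \<forall>m\<le>n.
        \<bar>real (zarankiewicz m n \<F>) - \<rho> * real m * real n powr (\<alpha> - 1)\<bar>
          \<le> C * real n powr \<beta>)"

end

theory Submission
  imports Defs
begin

text \<open>
  Let \<open>d = \<rho> (2n/5)\<^sup>\<alpha>\<^sup>-\<^sup>1\<close> be the minimum degree. A set \<open>A\<close> of at least \<open>\<gamma>n\<close> vertices sends about
  \<open>|A| d\<close> edges to its neighbours, so by smoothness it has at least \<open>3n/8\<close> of them, and even that
  many with at least \<open>K\<close> neighbours in \<open>A\<close> for any constant \<open>K\<close>. The map \<open>\<Gamma>\<close> taking \<open>A\<close> to the
  vertices with at least \<open>K\<close> neighbours in \<open>A\<close> can be iterated, and a vertex of \<open>\<Gamma>\<^sup>t A\<close> starts a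
  path of length exactly \<open>t\<close> into \<open>A\<close> which avoids any few given vertices. Up to \<open>\<gamma>n\<close> vertices
  \<open>A \<subseteq> \<Gamma>\<^sup>2 A\<close>, so the sets \<open>\<Gamma>\<^sup>2\<^sup>j A\<close> stabilise; either they then meet their
  neighbourhoods, so that even and odd paths lead from common vertices into \<open>A\<close>, or \<open>G\<close> is
  bipartite up to few edges. Because \<open>\<beta> < \<alpha>\<close>, small sets grow by a factor \<open>n\<^sup>\<eta>\<close>, so any two or
  three roots have disjoint trees of a constant exact depth with linearly many leaves and
  \<open>o(n)\<close> other vertices.

  If \<open>G\<close> is far from bipartite, grow trees from three neighbours of one vertex: of three sets
  of density \<open>3/8\<close> two meet, which closes an odd cycle of any prescribed large length.
  If \<open>G\<close> is nearly bipartite, take a maximum cut. An edge \<open>xy\<close> inside a part would be closed to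
  an odd cycle by growing trees from \<open>x\<close> and \<open>y\<close> along crossing edges, as two sets of density
  \<open>3/8\<close> on a side of density at most \<open>5/8\<close> meet. Only \<open>1/3 < 3/8 < 2/5\<close> is used, and the
  error term \<open>g = 0\<close> suffices.
\<close>

section \<open>Edge counts and cuts\<close>

text \<open>Ordered pairs are counted: edges inside \<open>A\<close> contribute twice to \<open>edge_count adj A A\<close>.\<close>

definition edge_count :: "('a \<Rightarrow> 'a \<Rightarrow> bool) \<Rightarrow> 'a set \<Rightarrow> 'a set \<Rightarrow> nat" where
  "edge_count adj A B = card {(a, b). a \<in> A \<and> b \<in> B \<and> adj a b}"

lemma edge_count_eq_sum:
  assumes "finite A" "finite B"
  shows "edge_count adj A B = (\<Sum>a\<in>A. card {b \<in> B. adj a b})"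
proof -
  have "{(a, b). a \<in> A \<and> b \<in> B \<and> adj a b} = (SIGMA a:A. {b \<in> B. adj a b})" by auto
  then show ?thesis using assms by (simp add: edge_count_def card_SigmaI)
qed

lemma finite_edge_pairs: "finite A \<Longrightarrow> finite B \<Longrightarrow> finite {(a, b). a \<in> A \<and> b \<in> B \<and> adj a b}"
  by (rule finite_subset[of _ "A \<times> B"]) auto

lemma edge_count_mono:
  assumes "A \<subseteq> A'" "B \<subseteq> B'" "finite A'" "finite B'" "\<And>a b. a \<in> A \<Longrightarrow> b \<in> B \<Longrightarrow> adj a b \<Longrightarrow> adj' a b"
  shows "edge_count adj A B \<le> edge_count adj' A' B'"
  unfolding edge_count_def by (rule card_mono[OF finite_edge_pairs]) (use assms in auto)

lemma edge_count_commute: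
  assumes "symp adj" shows "edge_count adj A B = edge_count adj B A"
  unfolding edge_count_def
  by (rule bij_betw_same_card[of prod.swap]) (use assms in \<open>auto simp: bij_betw_def inj_on_def image_def symp_def\<close>)

text \<open>Sets and relation may both change on the right, so that a count can be split by the
  position of an endpoint or by the type of the edge. The two pieces may overlap.\<close>

lemma edge_count_cover_le:
  assumes "finite A" "finite B" "finite A'" "finite B'" "finite A''" "finite B''"
    and "\<And>a b. a \<in> A \<Longrightarrow> b \<in> B \<Longrightarrow> adj a b \<Longrightarrow>
      (a \<in> A' \<and> b \<in> B' \<and> adj' a b) \<or> (a \<in> A'' \<and> b \<in> B'' \<and> adj'' a b)"
  shows "edge_count adj A B \<le> edge_count adj' A' B' + edge_count adj'' A'' B''"
proof -
  have "edge_count adj A B \<le> card ({(a, b). a \<in> A' \<and> b \<in> B' \<and> adj' a b} \<union> {(a, b). a \<in> A'' \<and> b \<in> B'' \<and> adj'' a b})"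
    unfolding edge_count_def
    by (rule card_mono) (use assms in \<open>auto intro!: finite_edge_pairs\<close>)
  also have "\<dots> \<le> edge_count adj' A' B' + edge_count adj'' A'' B''"
    unfolding edge_count_def by (rule card_Un_le)
  finally show ?thesis .
qed

lemma edge_count_Un_right_le:
  assumes "finite A" "finite B" "finite B'"
  shows "edge_count adj A (B \<union> B') \<le> edge_count adj A B + edge_count adj A B'"
  by (rule edge_count_cover_le) (use assms in auto)

lemma edge_count_Un_right:
  assumes "finite A" "finite B" "finite B'" "B \<inter> B' = {}"
  shows "edge_count adj A (B \<union> B') = edge_count adj A B + edge_count adj A B'"
proof -
  have "{(a, b). a \<in> A \<and> b \<in> B \<union> B' \<and> adj a b} =
    {(a, b). a \<in> A \<and> b \<in> B \<and> adj a b} \<union> {(a, b). a \<in> A \<and> b \<in> B' \<and> adj a b}" by auto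
  then show ?thesis unfolding edge_count_def
    using assms by (auto intro!: card_Un_disjoint finite_edge_pairs)
qed

lemma edge_count_le_mult:
  assumes "finite A" "finite B" shows "edge_count adj A B \<le> card A * card B"
proof -
  have "edge_count adj A B \<le> card (A \<times> B)"
    unfolding edge_count_def by (rule card_mono) (use assms in auto)
  then show ?thesis by (simp add: card_cartesian_product)
qed

lemma edge_count_le_of_degree:
  assumes "finite A" "finite B" "\<And>a. a \<in> A \<Longrightarrow> card {b \<in> B. adj a b} \<le> d"
  shows "edge_count adj A B \<le> card A * d"
  using sum_bounded_above[of A "\<lambda>a. card {b \<in> B. adj a b}" d] assms
  by (simp add: edge_count_eq_sum)

lemma edge_count_ge_of_degree:
  assumes "finite A" "finite B" "\<And>a. a \<in> A \<Longrightarrow> d \<le> real (card {b \<in> B. adj a b})"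
  shows "real (card A) * d \<le> real (edge_count adj A B)"
  using sum_bounded_below[of A d "\<lambda>a. real (card {b \<in> B. adj a b})"] assms
  by (simp add: edge_count_eq_sum)

section \<open>Maximum cuts\<close>

definition inner_edges :: "('a \<Rightarrow> 'a \<Rightarrow> bool) \<Rightarrow> 'a set \<Rightarrow> 'a set \<Rightarrow> nat" where
  "inner_edges adj V X = edge_count adj X X + edge_count adj (V - X) (V - X)"

lemma edge_count_insert_self:
  assumes "finite X" "v \<notin> X" "symp adj" "irreflp adj"
  shows "edge_count adj (insert v X) (insert v X) = edge_count adj X X + 2 * card {x \<in> X. adj v x}"
proof -
  have v: "{b. b = v \<and> adj v b} = {}" "{b \<in> X. adj v b} = {b \<in> insert v X. adj v b}"
    using assms by (auto simp: irreflp_def)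
  have "edge_count adj (insert v X) (insert v X) = edge_count adj {v} (insert v X) + edge_count adj X (insert v X)"
    using assms by (simp add: edge_count_eq_sum)
  also have "edge_count adj {v} (insert v X) = card {x \<in> X. adj v x}"
    using assms v by (simp add: edge_count_eq_sum)
  also have "edge_count adj X (insert v X) = edge_count adj X X + edge_count adj X {v}"
    using edge_count_Un_right[of X X "{v}" adj] assms by simp
  also have "edge_count adj X {v} = edge_count adj {v} X"
    using assms by (intro edge_count_commute)
  also have "\<dots> = card {x \<in> X. adj v x}" using assms by (simp add: edge_count_eq_sum)
  finally show ?thesis by simp
qed

text \<open>\<open>inner_edges\<close> counts every edge inside a side of the cut twice, so moving
  \<open>v\<close> out of \<open>X\<close> lowers it by twice the degree of \<open>v\<close> into
  \<open>X\<close> and raises it by twice the degree into \<open>V - X\<close>.\<close>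

lemma cut_move_le:
  assumes "finite V" "X \<subseteq> V" "v \<in> X" "symp adj" "irreflp adj"
    and "inner_edges adj V X \<le> inner_edges adj V (X - {v})"
  shows "card {w \<in> X. adj v w} \<le> card {w \<in> V - X. adj v w}"
proof -
  have fin: "finite X" using assms finite_subset by blast
  have "edge_count adj X X = edge_count adj (X - {v}) (X - {v}) + 2 * card {x \<in> X - {v}. adj v x}"
    using edge_count_insert_self[of "X - {v}" v adj] assms fin by (simp add: insert_absorb)
  moreover have "{x \<in> X - {v}. adj v x} = {x \<in> X. adj v x}" using assms by (auto simp: irreflp_def)
  moreover have "V - (X - {v}) = insert v (V - X)" using assms by auto
  moreover have "edge_count adj (insert v (V - X)) (insert v (V - X)) =
    edge_count adj (V - X) (V - X) + 2 * card {x \<in> V - X. adj v x}"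
    using edge_count_insert_self[of "V - X" v adj] assms by simp
  ultimately show ?thesis using assms(6) unfolding inner_edges_def by simp
qed

text \<open>A set minimising \<open>inner_edges\<close> is a side of a maximum cut, and no single
  move improves it. The resulting degree bound is what later lets trees grow along crossing edges
  only.\<close>

lemma max_cut_exists:
  assumes "finite V" "symp adj" "irreflp adj"
  obtains X where "X \<subseteq> V" "\<And>X'. X' \<subseteq> V \<Longrightarrow> inner_edges adj V X \<le> inner_edges adj V X'"
    "\<And>v. v \<in> V \<Longrightarrow> card {w \<in> V. adj v w} \<le> 2 * card {w \<in> V. adj v w \<and> (v \<in> X \<longleftrightarrow> w \<notin> X)}"
proof -
  obtain X where X: "X \<in> Pow V" "\<And>X'. X' \<in> Pow V \<Longrightarrow> inner_edges adj V X \<le> inner_edges adj V X'"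
    using arg_min_on_def ex_is_arg_min_if_finite[of "Pow V" "inner_edges adj V"] assms(1)
    by (auto simp: is_arg_min_linorder)
  have inner_compl: "inner_edges adj V (V - Z) = inner_edges adj V Z" if "Z \<subseteq> V" for Z
    using that by (simp add: inner_edges_def double_diff)
  have "card {w \<in> V. adj v w} \<le> 2 * card {w \<in> V. adj v w \<and> (v \<in> X \<longleftrightarrow> w \<notin> X)}" if v: "v \<in> V" for v
  proof -
    \<comment> \<open>\<open>Z\<close> is the side of \<open>v\<close>. Complementation does not
      change \<open>inner_edges\<close>, so \<open>Z\<close> is a minimiser too and both positions
      of \<open>v\<close> are treated at once.\<close>
    define Z where "Z = (if v \<in> X then X else V - X)"
    have Z: "Z \<subseteq> V" "v \<in> Z" using v X by (auto simp: Z_def)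
    have "inner_edges adj V Z = inner_edges adj V X" using X inner_compl by (auto simp: Z_def)
    then have "card {w \<in> Z. adj v w} \<le> card {w \<in> V - Z. adj v w}"
      using cut_move_le[OF assms(1) Z assms(2,3)] X(2)[of "Z - {v}"] Z by auto
    moreover have "{w \<in> V - Z. adj v w} = {w \<in> V. adj v w \<and> (v \<in> X \<longleftrightarrow> w \<notin> X)}"
      using X(1) by (auto simp: Z_def)
    moreover have "{w \<in> V. adj v w} = {w \<in> Z. adj v w} \<union> {w \<in> V - Z. adj v w}" using Z by auto
    then have "card {w \<in> V. adj v w} \<le> card {w \<in> Z. adj v w} + card {w \<in> V - Z. adj v w}"
      by (metis card_Un_le)
    ultimately show ?thesis by simp
  qed
  then show ?thesis using that X by auto
qed

section \<open>Robust neighbourhoods\<close>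

definition robust_nbhd :: "('a \<Rightarrow> 'a \<Rightarrow> bool) \<Rightarrow> 'a set \<Rightarrow> nat \<Rightarrow> 'a set \<Rightarrow> 'a set" where
  "robust_nbhd adj V K A = {v \<in> V. K \<le> card {a \<in> A. adj v a}}"

lemma mem_robust_nbhd: "v \<in> robust_nbhd adj V K A \<longleftrightarrow> v \<in> V \<and> K \<le> card {a \<in> A. adj v a}"
  by (simp add: robust_nbhd_def)

lemma robust_nbhd_subset: "robust_nbhd adj V K A \<subseteq> V"
  by (auto simp: robust_nbhd_def)

lemma robust_nbhd_mono:
  assumes "finite B" "A \<subseteq> B"
  shows "robust_nbhd adj V K A \<subseteq> robust_nbhd adj V K B"
proof -
  have "card {a \<in> A. adj v a} \<le> card {a \<in> B. adj v a}" for v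
    by (rule card_mono) (use assms in auto)
  then show ?thesis by (auto simp: robust_nbhd_def intro: order_trans)
qed

text \<open>Vertices outside the robust neighbourhood have fewer than \<open>K\<close> neighbours in
  \<open>A\<close>. For constant \<open>K\<close> a loss of K n edges is negligible against
  n^\<alpha>, as \<alpha> > 1.\<close>

lemma edge_count_outside_robust_nbhd:
  assumes "finite V" "symp adj" "A \<subseteq> V" "Z \<subseteq> V - robust_nbhd adj V K A"
  shows "edge_count adj A Z \<le> K * card V"
proof -
  have fin: "finite A" "finite Z" using assms by (meson finite_Diff finite_subset)+
  have "edge_count adj A Z = edge_count adj Z A" by (rule edge_count_commute) fact
  also have "\<dots> \<le> card Z * K"
    by (rule edge_count_le_of_degree) (use fin assms in \<open>auto simp: robust_nbhd_def\<close>)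
  also have "\<dots> \<le> card V * K" using assms by (intro mult_right_mono card_mono) auto
  finally show ?thesis by (simp add: mult.commute)
qed

text \<open>Greedy choice: every step offers \<open>K\<close> candidates, while fewer than
  \<open>K\<close> vertices are forbidden or already on the path. Only the tail has to avoid
  \<open>F\<close>, so a second path may start at a vertex of the first one.\<close>

lemma robust_path:
  assumes "finite V" "w \<in> (robust_nbhd adj V K ^^ t) S" "S \<subseteq> V" "finite F" "card F + t < K"
  shows "\<exists>p. length p = Suc t \<and> hd p = w \<and> last p \<in> S \<and> distinct p \<and> successively adj p \<and>
    set (tl p) \<inter> F = {} \<and> set p \<subseteq> V"
  using assms(2,4,5)
proof (induction t arbitrary: w F)
  case 0
  then show ?case using assms(3) by (intro exI[of _ "[w]"]) auto
next
  case (Suc t)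
  let ?A = "(robust_nbhd adj V K ^^ t) S"
  have w: "w \<in> V" "K \<le> card {a \<in> ?A. adj w a}" using Suc.prems(1) by (simp_all add: mem_robust_nbhd)
  \<comment> \<open>The current vertex joins the forbidden set, which keeps the path simple; as one
    step has been spent, card F + t does not grow.\<close>
  have "card (insert w F) < K" using Suc.prems by (simp add: card_insert_if)
  then have "\<not> {a \<in> ?A. adj w a} \<subseteq> insert w F"
    using w(2) Suc.prems(2) card_mono[of "insert w F" "{a \<in> ?A. adj w a}"] by auto
  then obtain w' where w': "w' \<in> ?A" "adj w w'" "w' \<notin> insert w F" by auto
  have "card (insert w F) + t < K" using Suc.prems by (simp add: card_insert_if)
  then obtain p where p: "length p = Suc t" "hd p = w'" "last p \<in> S" "distinct p" "successively adj p"
    "set (tl p) \<inter> insert w F = {}" "set p \<subseteq> V"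
    using Suc.IH[OF w'(1), of "insert w F"] Suc.prems by auto
  obtain p' where p': "p = w' # p'" using p(1,2) by (cases p) auto
  show ?case using p w w' by (intro exI[of _ "w # p"]) (auto simp: p')
qed

lemma robust_iterate_mono:
  assumes "finite V" "A \<subseteq> B" "B \<subseteq> V"
  shows "(robust_nbhd adj V K ^^ t) A \<subseteq> (robust_nbhd adj V K ^^ t) B"
    and "(robust_nbhd adj V K ^^ t) B \<subseteq> V"
proof -
  have V: "(robust_nbhd adj V K ^^ t) B \<subseteq> V" for t
    using assms robust_nbhd_subset[of adj V K] by (cases t) auto
  show "(robust_nbhd adj V K ^^ t) B \<subseteq> V" by (rule V)
  show "(robust_nbhd adj V K ^^ t) A \<subseteq> (robust_nbhd adj V K ^^ t) B"
  proof (induction t)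
    case (Suc t)
    then show ?case using robust_nbhd_mono[OF finite_subset[OF V assms(1)]] by auto
  qed (use assms in auto)
qed

lemma robust_iterate_large:
  fixes a b :: real
  assumes "\<And>A. A \<subseteq> V \<Longrightarrow> a \<le> card A \<Longrightarrow> b \<le> card (robust_nbhd adj V K A)"
    and "a \<le> b" "S \<subseteq> V" "a \<le> card S" "0 < t"
  shows "b \<le> card ((robust_nbhd adj V K ^^ t) S)"
  using assms(5)
proof (induction t)
  case (Suc t)
  show ?case
  proof (cases "t = 0")
    case False
    then have "(robust_nbhd adj V K ^^ t) S \<subseteq> V" using robust_nbhd_subset[of adj V K] by (cases t) auto
    then show ?thesis using Suc False assms(1,2) by simp
  qed (use assms in simp)
qed simp

text \<open>The even iterates of \<open>S\<close> almost contain their predecessors and are bounded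
  by \<open>V\<close>, so some consecutive two, \<open>E\<close> and \<open>E'\<close>, nearly
  agree. With \<open>Od\<close> between them, either \<open>E\<close> and \<open>Od\<close> share
  many vertices, whose iterates then lie in iterates of \<open>S\<close> of both parities, or
  \<open>E - Od\<close> and \<open>Od - E'\<close> span few edges and cover almost all of
  \<open>V\<close>. The bound in \<open>expand\<close> is 2 K n because two losses of K n are added
  in its applications.\<close>

lemma robust_dichotomy:
  fixes \<gamma> :: real and K n :: nat
  assumes V: "finite V" "card V = n" "n > 0" and adj: "symp adj"
    and \<gamma>: "0 < \<gamma>" "\<gamma> \<le> 1 / 100"
    and expand: "\<And>A B. A \<subseteq> V \<Longrightarrow> B \<subseteq> V \<Longrightarrow> \<gamma> * n \<le> card A \<Longrightarrow>
      edge_count adj A (V - B) \<le> 2 * K * n \<Longrightarrow> 3 / 8 * n \<le> real (card B)"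
    and S: "S \<subseteq> V" "\<gamma> * n \<le> card S" and J: "1 / \<gamma> \<le> real J"
  defines "\<Gamma> \<equiv> robust_nbhd adj V K"
  shows "(\<forall>t\<ge>2 * J + 4. 3 / 8 * n \<le> real (card ((\<Gamma> ^^ t) S \<inter> (\<Gamma> ^^ Suc t) S))) \<or>
    (\<exists>P Q. P \<subseteq> V \<and> Q \<subseteq> V \<and> P \<inter> Q = {} \<and> card (V - (P \<union> Q)) \<le> 7 * \<gamma> * n \<and>
      edge_count adj P P \<le> K * n \<and> edge_count adj Q Q \<le> K * n)"
proof -
  have fin: "finite A" if "A \<subseteq> V" for A using that V finite_subset by blast
  have \<Gamma>V: "\<Gamma> A \<subseteq> V" for A unfolding \<Gamma>_def by (rule robust_nbhd_subset)
  have outside: "edge_count adj A Z \<le> K * n" if "A \<subseteq> V" "Z \<subseteq> V - \<Gamma> A" for A Z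
    using edge_count_outside_robust_nbhd[OF V(1) adj that(1)] that(2) V(2) by (auto simp: \<Gamma>_def)
  have big: "3 / 8 * n \<le> real (card (\<Gamma> A))" if "A \<subseteq> V" "\<gamma> * n \<le> card A" for A
    using expand[OF that(1) \<Gamma>V that(2), of A] outside[OF that(1), of "V - \<Gamma> A"] by simp
  have large: "\<gamma> * n \<le> x" if "3 / 8 * n \<le> x" for x
  proof -
    have "\<gamma> * n \<le> 1 / 100 * n" using \<gamma> by (intro mult_right_mono) auto
    then show ?thesis using that by simp
  qed
  have iter_big: "3 / 8 * n \<le> real (card ((\<Gamma> ^^ t) A)) \<and> (\<Gamma> ^^ t) A \<subseteq> V"
    if "A \<subseteq> V" "\<gamma> * n \<le> card A" "t > 0" for A t
    using that(3)
  proof (induction t)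
    case (Suc t)
    then show ?case using that big \<Gamma>V large by (cases "t = 0") auto
  qed simp
  \<comment> \<open>Few edges of \<open>D\<close> leave \<open>\<Gamma> A\<close> because
    \<open>D\<close> lies in \<open>A\<close>, and few enter \<open>\<Gamma> A\<close> because
    \<open>D\<close> avoids \<open>\<Gamma> (\<Gamma> A)\<close>. If \<open>D\<close> were large,
    \<open>expand\<close> would apply with the empty set as \<open>B\<close>, which is
    absurd.\<close>
  have return: "card (A - \<Gamma> (\<Gamma> A)) < \<gamma> * n" if A: "A \<subseteq> V" for A
  proof (rule ccontr)
    define D where "D = A - \<Gamma> (\<Gamma> A)"
    assume "\<not> real (card (A - \<Gamma> (\<Gamma> A))) < \<gamma> * n"
    then have D: "\<gamma> * n \<le> card D" "D \<subseteq> V" using A by (auto simp: D_def)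
    have "edge_count adj D (V - \<Gamma> A) \<le> edge_count adj A (V - \<Gamma> A)"
      by (rule edge_count_mono) (use A V fin in \<open>auto simp: D_def\<close>)
    also have "\<dots> \<le> K * n" using outside[OF A] by simp
    finally have 1: "edge_count adj D (V - \<Gamma> A) \<le> K * n" .
    have 2: "edge_count adj (\<Gamma> A) D \<le> K * n" by (rule outside) (use \<Gamma>V A in \<open>auto simp: D_def\<close>)
    have "edge_count adj D (V - {}) \<le> edge_count adj D ((V - \<Gamma> A) \<union> \<Gamma> A)"
      by (rule edge_count_mono) (use D fin V \<Gamma>V in auto)
    also have "\<dots> \<le> edge_count adj D (V - \<Gamma> A) + edge_count adj D (\<Gamma> A)"
      by (rule edge_count_Un_right_le) (use D fin V \<Gamma>V in auto)
    also have "edge_count adj D (\<Gamma> A) = edge_count adj (\<Gamma> A) D" by (rule edge_count_commute[OF adj])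
    finally have "3 / 8 * n \<le> real (card ({}::'a set))"
      using expand[OF D(2) _ D(1), of "{}"] 1 2 by simp
    then show False using V by simp
  qed
  \<comment> \<open>If every double step gained 2\<gamma>n vertices while losing fewer than
    \<gamma>n, the even iterates would grow by \<gamma>n each time and exceed n after J + 2 double
    steps, as J \<ge> 1/\<gamma>.\<close>
  have "\<exists>j\<in>{1..J + 1}. card ((\<Gamma> ^^ (2 * j + 2)) S - (\<Gamma> ^^ (2 * j)) S) < 2 * \<gamma> * n"
  proof (rule ccontr)
    assume neg: "\<not> ?thesis"
    have step: "\<gamma> * n * real j \<le> card ((\<Gamma> ^^ (2 * j)) S)" if "j \<le> J + 2" for j
      using that
    proof (induction j)
      case (Suc j)
      show ?case
      proof (cases "j = 0")
        case True
        then show ?thesis using iter_big[OF S, of 2] large by (simp add: numeral_2_eq_2)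
      next
        case False
        let ?A = "(\<Gamma> ^^ (2 * j)) S" and ?B = "(\<Gamma> ^^ (2 * j + 2)) S"
        have j: "j \<in> {1..J + 1}" using False Suc.prems by auto
        have AV: "?A \<subseteq> V" "?B \<subseteq> V" using iter_big[OF S, of "2 * j"] False \<Gamma>V by auto
        have "card ?A = card (?A - ?B) + card (?A \<inter> ?B)"
          using fin[OF AV(1)] by (metis add.commute card_Int_Diff)
        moreover have "card ?B = card (?B - ?A) + card (?A \<inter> ?B)"
          using fin[OF AV(2)] by (metis add.commute card_Int_Diff Int_commute)
        moreover have "2 * \<gamma> * n \<le> card (?B - ?A)" using neg j by force
        moreover have "card (?A - ?B) < \<gamma> * n" using return[OF AV(1)] by simp
        moreover have "\<gamma> * n * real j \<le> card ?A" using Suc by simp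
        ultimately have "\<gamma> * n * real j + \<gamma> * n \<le> card ?B" by linarith
        then show ?thesis by (simp add: algebra_simps)
      qed
    qed simp
    have "card ((\<Gamma> ^^ (2 * (J + 2))) S) \<le> n"
      using iter_big[OF S, of "2 * (J + 2)"] V card_mono by auto
    then have "\<gamma> * n * real (J + 2) \<le> n" using step[of "J + 2"] by linarith
    moreover have "1 \<le> \<gamma> * J" using J \<gamma> by (simp add: field_simps)
    then have "real n * 1 < real n * (\<gamma> * real (J + 2))"
      using V(3) \<gamma> by (intro mult_strict_left_mono) (auto simp: algebra_simps)
    ultimately show False by (simp add: mult.assoc mult.left_commute)
  qed
  then obtain j where j: "1 \<le> j" "j \<le> J + 1"
    and close: "card ((\<Gamma> ^^ (2 * j + 2)) S - (\<Gamma> ^^ (2 * j)) S) < 2 * \<gamma> * n" by auto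
  define E where "E = (\<Gamma> ^^ (2 * j)) S"
  define Od where "Od = \<Gamma> E"
  define E' where "E' = \<Gamma> Od"
  have sub: "E \<subseteq> V" "Od \<subseteq> V" "E' \<subseteq> V" and cards: "3 / 8 * n \<le> card E" "3 / 8 * n \<le> card Od"
    using iter_big[OF S, of "2 * j"] iter_big[OF S, of "2 * j + 1"] iter_big[OF S, of "2 * j + 2"] j(1)
    by (auto simp: E_def Od_def E'_def)
  have close': "card (E' - E) < 2 * \<gamma> * n" using close by (simp add: E_def E'_def Od_def)
  show ?thesis
  proof (cases "\<gamma> * n \<le> card (E \<inter> Od)")
    case True
    have "3 / 8 * n \<le> real (card ((\<Gamma> ^^ t) S \<inter> (\<Gamma> ^^ Suc t) S))" if t: "t \<ge> 2 * J + 4" for t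
    proof -
      define i where "i = t - 2 * j"
      have i: "t = i + 2 * j" "0 < i" using t j by (auto simp: i_def)
      have W: "E \<inter> Od \<subseteq> V" using sub by auto
      have "(\<Gamma> ^^ i) (E \<inter> Od) \<subseteq> (\<Gamma> ^^ i) E" "(\<Gamma> ^^ i) (E \<inter> Od) \<subseteq> (\<Gamma> ^^ i) Od"
        using robust_iterate_mono(1)[OF V(1)] sub by (auto simp: \<Gamma>_def)
      moreover have "(\<Gamma> ^^ i) E = (\<Gamma> ^^ t) S" by (simp add: E_def i funpow_add)
      moreover have "(\<Gamma> ^^ i) Od = (\<Gamma> ^^ (i + Suc (2 * j))) S"
        unfolding funpow_add by (simp add: Od_def E_def)
      then have "(\<Gamma> ^^ i) Od = (\<Gamma> ^^ Suc t) S" by (simp only: i add_Suc_right)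
      ultimately have "(\<Gamma> ^^ i) (E \<inter> Od) \<subseteq> (\<Gamma> ^^ t) S \<inter> (\<Gamma> ^^ Suc t) S" by auto
      moreover have "finite ((\<Gamma> ^^ Suc t) S)" using \<Gamma>V fin by auto
      ultimately have "card ((\<Gamma> ^^ i) (E \<inter> Od)) \<le> card ((\<Gamma> ^^ t) S \<inter> (\<Gamma> ^^ Suc t) S)"
        by (intro card_mono) auto
      then show ?thesis using iter_big[OF W True i(2)] by linarith
    qed
    then show ?thesis by auto
  next
    case False
    \<comment> \<open>Few edges of \<open>E\<close> leave \<open>Od\<close>, hence few lie inside
      \<open>E - Od\<close>; in the same way few edges of \<open>Od\<close> leave
      \<open>E'\<close>.\<close>
    define P where "P = E - Od"
    define Q where "Q = Od - E'"
    have "edge_count adj P P \<le> edge_count adj E (V - Od)"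
      by (rule edge_count_mono) (use sub V fin in \<open>auto simp: P_def\<close>)
    also have "\<dots> \<le> K * n" using outside[of E] sub by (simp add: Od_def)
    finally have 1: "edge_count adj P P \<le> K * n" .
    have "edge_count adj Q Q \<le> edge_count adj Od (V - E')"
      by (rule edge_count_mono) (use sub V fin in \<open>auto simp: Q_def\<close>)
    also have "\<dots> \<le> K * n" using outside[of Od] sub by (simp add: E'_def)
    finally have 2: "edge_count adj Q Q \<le> K * n" .
    define Z where "Z = V - (E \<union> Od)"
    \<comment> \<open>Vertices of \<open>Z - E'\<close> lie outside both \<open>\<Gamma> E\<close>
      and \<open>\<Gamma> Od\<close>, so all but 2 K n of their edges stay in \<open>Z\<close>. If
      there were \<gamma>n of them, \<open>Z\<close> would have 3n/8 vertices, and with the nearly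
      disjoint \<open>E\<close> and \<open>Od\<close> this makes more than n.\<close>
    have Z': "card (Z - E') < \<gamma> * n"
    proof (rule ccontr)
      assume "\<not> real (card (Z - E')) < \<gamma> * n"
      then have Z1: "\<gamma> * n \<le> card (Z - E')" "Z - E' \<subseteq> V" by (auto simp: Z_def)
      have "edge_count adj E (Z - E') \<le> K * n" by (rule outside) (use sub in \<open>auto simp: Z_def Od_def\<close>)
      moreover have "edge_count adj Od (Z - E') \<le> K * n" by (rule outside) (use sub in \<open>auto simp: Z_def E'_def\<close>)
      moreover have "edge_count adj (Z - E') (V - Z) \<le> edge_count adj (Z - E') (E \<union> Od)"
        by (rule edge_count_mono) (use sub V fin in \<open>auto simp: Z_def\<close>)
      moreover have "\<dots> \<le> edge_count adj (Z - E') E + edge_count adj (Z - E') Od"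
        by (rule edge_count_Un_right_le) (use sub V fin in \<open>auto simp: Z_def\<close>)
      ultimately have "edge_count adj (Z - E') (V - Z) \<le> 2 * K * n"
        using edge_count_commute[OF adj, of "Z - E'"] by simp
      then have "3 / 8 * n \<le> card Z" using expand[OF Z1(2) _ Z1(1), of Z] by (auto simp: Z_def)
      moreover have "card (E \<union> Od) + card Z = n"
        using sub V card_Un_disjoint[of "E \<union> Od" Z] by (simp add: Z_def fin Un_absorb1)
      moreover have "card E + card Od = card (E \<union> Od) + card (E \<inter> Od)"
        using card_Un_Int fin sub by blast
      moreover have "card (E \<inter> Od) \<le> 1 / 100 * n"
        using False mult_right_mono[OF \<gamma>(2), of n] by linarith
      ultimately show False using cards V(3) by linarith
    qed
    \<comment> \<open>Vertices of \<open>E\<close> outside \<open>P\<close> lie in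
      \<open>Od\<close>, those of \<open>Od\<close> outside \<open>Q\<close> lie in
      \<open>E'\<close>. The three pieces have fewer than \<gamma>n, 2\<gamma>n and \<gamma>n
      vertices.\<close>
    have "V - (P \<union> Q) \<subseteq> (E \<inter> Od) \<union> (E' - E) \<union> (Z - E')"
      by (auto simp: P_def Q_def Z_def)
    then have "card (V - (P \<union> Q)) \<le> card ((E \<inter> Od) \<union> (E' - E) \<union> (Z - E'))"
      by (intro card_mono) (use fin sub V in \<open>auto simp: Z_def\<close>)
    also have "\<dots> \<le> card (E \<inter> Od) + card (E' - E) + card (Z - E')"
      by (metis add_le_mono1 card_Un_le order_trans)
    finally have "card (V - (P \<union> Q)) \<le> 7 * \<gamma> * n"
      using False Z' close' mult_nonneg_nonneg[of \<gamma> n] \<gamma> by linarith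
    then show ?thesis using 1 2 sub by (intro disjI2 exI[of _ P] exI[of _ Q]) (auto simp: P_def Q_def)
  qed
qed

section \<open>Expansion from density bounds\<close>

lemma eventually_powr_le:
  fixes a b e D :: real
  assumes "a < b" "0 < e"
  shows "\<forall>\<^sub>F n in sequentially. D * real n powr a \<le> e * real n powr b"
proof -
  have "(\<lambda>n. D * real n powr (a - b)) \<longlonglongrightarrow> D * 0"
    using assms by (intro tendsto_mult tendsto_const tendsto_neg_powr filterlim_real_sequentially) auto
  then have "\<forall>\<^sub>F n in sequentially. D * real n powr (a - b) < e"
    using assms by (intro order_tendstoD(2)[of _ 0]) auto
  then show ?thesis
  proof eventually_elim
    case (elim n)
    have "D * real n powr a = (D * real n powr (a - b)) * real n powr b"
      by (simp flip: powr_add)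
    also have "\<dots> \<le> e * real n powr b" using elim by (intro mult_right_mono) auto
    finally show ?case .
  qed
qed

lemma powr_split: "x powr a = x * x powr (a - 1)" if "0 \<le> x" "a \<noteq> 0" for x a :: real
  using that by (cases "x = 0") (simp_all add: powr_diff)

section \<open>Graphs with bounded density between disjoint sets\<close>

locale density_bound =
  fixes \<alpha> \<beta> \<rho> C :: real
  assumes exps: "1 \<le> \<beta>" "\<beta> < \<alpha>" "\<alpha> < 2" and \<rho>: "0 < \<rho>" and C: "0 \<le> C"
begin

text \<open>The upper estimate that smoothness provides, phrased for an adjacency relation: the
  family does not occur, and the property passes to subgraphs. It is demanded for sets of all sizes,
  so \<open>C\<close> must also cover those below the threshold of smoothness.\<close>

definition thin :: "'a set \<Rightarrow> ('a \<Rightarrow> 'a \<Rightarrow> bool) \<Rightarrow> bool" where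
  "thin V adj \<longleftrightarrow> finite V \<and> symp adj \<and> irreflp adj \<and>
    (\<forall>A B. A \<subseteq> V \<longrightarrow> B \<subseteq> V \<longrightarrow> A \<inter> B = {} \<longrightarrow> card A \<le> card B \<longrightarrow>
      real (edge_count adj A B) \<le> \<rho> * card A * card B powr (\<alpha> - 1) + C * card B powr \<beta>)"

lemma thinD:
  assumes "thin V adj"
  shows "finite V" "symp adj" "irreflp adj"
  using assms by (simp_all add: thin_def)

lemma thin_ordered:
  "thin V adj \<Longrightarrow> A \<subseteq> V \<Longrightarrow> B \<subseteq> V \<Longrightarrow> A \<inter> B = {} \<Longrightarrow> card A \<le> card B \<Longrightarrow>
    real (edge_count adj A B) \<le> \<rho> * card A * card B powr (\<alpha> - 1) + C * card B powr \<beta>"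
  by (simp add: thin_def)

lemma thin_mono:
  assumes V: "thin V adj" and "V' \<subseteq> V" "\<And>u v. adj' u v \<Longrightarrow> adj u v" "symp adj'"
  shows "thin V' adj'"
  unfolding thin_def
proof (intro conjI allI impI)
  show "finite V'" using thinD[OF V] assms finite_subset by blast
  show "irreflp adj'" using thinD(3)[OF V] assms by (auto simp: irreflp_def)
next
  fix A B assume *: "A \<subseteq> V'" "B \<subseteq> V'" "A \<inter> B = {}" "card A \<le> card B"
  have "edge_count adj' A B \<le> edge_count adj A B"
    by (rule edge_count_mono) (use * assms finite_subset[OF _ thinD(1)[OF V]] in auto)
  moreover have "real (edge_count adj A B) \<le> \<rho> * card A * card B powr (\<alpha> - 1) + C * card B powr \<beta>"
    by (rule thin_ordered[OF V]) (use * assms(2) in auto)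
  ultimately show "real (edge_count adj' A B) \<le> \<rho> * card A * card B powr (\<alpha> - 1) + C * card B powr \<beta>"
    by linarith
qed fact

text \<open>A common bound \<open>q\<close> removes the ordering of the two sizes: the smaller one
  is at most card A and the larger one at most q, whichever set is which.\<close>

lemma thin_bound:
  fixes q :: real
  assumes V: "thin V adj" and AB: "A \<subseteq> V" "B \<subseteq> V" "A \<inter> B = {}" "card A \<le> q" "card B \<le> q"
  shows "real (edge_count adj A B) \<le> \<rho> * card A * q powr (\<alpha> - 1) + C * q powr \<beta>"
proof -
  define a b where "a = min (card A) (card B)" and "b = max (card A) (card B)"
  have "real (edge_count adj A B) \<le> \<rho> * a * b powr (\<alpha> - 1) + C * b powr \<beta>"
  proof (cases "card A \<le> card B")
    case True
    then show ?thesis using V AB by (simp add: thin_def a_def b_def min_def max_def)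
  next
    case False
    have "real (edge_count adj B A) \<le> \<rho> * card B * card A powr (\<alpha> - 1) + C * card A powr \<beta>"
      by (rule thin_ordered[OF V]) (use AB False in auto)
    then show ?thesis using False edge_count_commute[OF thinD(2)[OF V], of A B]
      by (simp add: a_def b_def min_def max_def)
  qed
  also have "\<rho> * a * b powr (\<alpha> - 1) \<le> \<rho> * card A * q powr (\<alpha> - 1)"
    using \<rho> exps AB by (intro mult_mono powr_mono2) (auto simp: a_def b_def)
  also have "C * b powr \<beta> \<le> C * q powr \<beta>"
    using C exps AB by (intro mult_mono powr_mono2) (auto simp: b_def)
  finally show ?thesis by simp
qed

text \<open>Sets overlap themselves, so \<open>thin\<close> only applies to the crossing edges of a maximum cut;
  this costs a factor of \<open>4\<close> and keeps the exponent.\<close>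

lemma thin_self:
  assumes V: "thin V adj" and M: "M \<subseteq> V"
  shows "real (edge_count adj M M) \<le> 4 * (\<rho> + C) * card M powr \<alpha>"
proof (cases "M = {}")
  case True
  then show ?thesis by (simp add: edge_count_def)
next
  case False
  have fin: "finite M" using thinD[OF V] M finite_subset by blast
  obtain X where X: "X \<subseteq> M" and "\<And>X'. X' \<subseteq> M \<Longrightarrow> inner_edges adj M X \<le> inner_edges adj M X'"
    and half: "\<And>v. v \<in> M \<Longrightarrow> card {w \<in> M. adj v w} \<le> 2 * card {w \<in> M. adj v w \<and> (v \<in> X \<longleftrightarrow> w \<notin> X)}"
    by (rule max_cut_exists[OF fin thinD(2,3)[OF V]]) blast
  let ?cross = "\<lambda>v w. adj v w \<and> (v \<in> X \<longleftrightarrow> w \<notin> X)"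
  have "edge_count adj M M \<le> (\<Sum>v\<in>M. 2 * card {w \<in> M. ?cross v w})"
    using half fin by (simp add: edge_count_eq_sum sum_mono)
  also have "\<dots> = 2 * edge_count ?cross M M"
    using fin by (simp add: edge_count_eq_sum sum_distrib_left)
  also have "edge_count ?cross M M \<le> edge_count adj X (M - X) + edge_count adj (M - X) X"
    by (rule edge_count_cover_le) (use fin X finite_subset in auto)
  also have "\<dots> = 2 * edge_count adj X (M - X)"
    using edge_count_commute[OF thinD(2)[OF V], of X] by simp
  finally have 1: "edge_count adj M M \<le> 4 * edge_count adj X (M - X)" by simp
  have "card X \<le> card M" using fin X card_mono by blast
  moreover have "card (M - X) \<le> card M" using fin card_mono by blast
  ultimately have "real (edge_count adj X (M - X)) \<le> \<rho> * card X * card M powr (\<alpha> - 1) + C * card M powr \<beta>"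
    by (intro thin_bound[OF V]) (use X M in auto)
  also have "\<rho> * card X * card M powr (\<alpha> - 1) \<le> \<rho> * card M * card M powr (\<alpha> - 1)"
    using \<open>card X \<le> card M\<close> \<rho> by (intro mult_right_mono mult_left_mono) auto
  also have "\<dots> = \<rho> * card M powr \<alpha>" using exps powr_split[of "card M" \<alpha>] by simp
  also have "C * card M powr \<beta> \<le> C * card M powr \<alpha>"
  proof -
    have "card M \<noteq> 0" using False fin by simp
    then show ?thesis using exps C by (intro mult_left_mono powr_mono) auto
  qed
  finally show ?thesis using 1 by (simp add: algebra_simps)
qed

text \<open>Edges at \<open>M\<close> lie inside \<open>M\<close> or lead to \<open>V - M\<close>;
  both kinds number O(|M| n^(\<alpha>-1)) up to an error of order n^\<beta>. This makes it harmless
  to delete the inner tree vertices and other small sets.\<close>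

lemma small_set:
  assumes "0 < \<kappa>"
  shows "\<exists>\<mu>::real. \<mu> > 0 \<and> (\<forall>\<^sub>F n in sequentially. \<forall>(V :: 'a set) (adj :: 'a \<Rightarrow> 'a \<Rightarrow> bool). thin V adj \<and> card V = n \<longrightarrow>
    (\<forall>M\<subseteq>V. card M \<le> \<mu> * n \<longrightarrow> real (edge_count adj M V) \<le> \<kappa> * n powr \<alpha>))"
proof -
  \<comment> \<open>The coefficient 5\<rho> + 4C is 4(\<rho> + C) from \<open>thin_self\<close> plus
    \<rho> from \<open>thin_bound\<close>. Half of \<kappa> is reserved for the error C
    n^\<beta>.\<close>
  define \<mu> where "\<mu> = \<kappa> / (2 * (5 * \<rho> + 4 * C))"
  have W: "0 < 5 * \<rho> + 4 * C" using \<rho> C by simp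
  then have \<mu>: "0 < \<mu>" using assms by (simp add: \<mu>_def)
  have "\<forall>\<^sub>F n in sequentially. C * real n powr \<beta> \<le> \<kappa> / 2 * real n powr \<alpha>"
    using exps assms by (intro eventually_powr_le) auto
  then have "\<forall>\<^sub>F n in sequentially. \<forall>(V :: 'a set) (adj :: 'a \<Rightarrow> 'a \<Rightarrow> bool). thin V adj \<and> card V = n \<longrightarrow>
    (\<forall>M\<subseteq>V. card M \<le> \<mu> * n \<longrightarrow> real (edge_count adj M V) \<le> \<kappa> * n powr \<alpha>)"
  proof eventually_elim
    case (elim n)
    show ?case
    proof (intro allI impI, elim conjE)
      fix V :: "'a set" and adj :: "'a \<Rightarrow> 'a \<Rightarrow> bool" and M
      assume V: "thin V adj" "card V = n" and M: "M \<subseteq> V" "card M \<le> \<mu> * n"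
      have fin: "finite V" "finite M" using thinD[OF V(1)] M finite_subset by blast+
      have le: "card M \<le> n" "card (V - M) \<le> n" using card_mono[OF fin(1), of M] card_mono[OF fin(1), of "V - M"] V M by auto
      have "edge_count adj M V \<le> edge_count adj M (M \<union> (V - M))"
        by (rule edge_count_mono) (use fin M in auto)
      also have "\<dots> \<le> edge_count adj M M + edge_count adj M (V - M)"
        by (rule edge_count_Un_right_le) (use fin in auto)
      finally have 1: "real (edge_count adj M V) \<le> real (edge_count adj M M) + edge_count adj M (V - M)"
        by linarith
      have 2: "real (edge_count adj M (V - M)) \<le> \<rho> * card M * n powr (\<alpha> - 1) + C * n powr \<beta>"
        using le by (intro thin_bound[OF V(1)]) (use M in auto)
      have "card M powr \<alpha> = card M * card M powr (\<alpha> - 1)"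
        using exps by (intro powr_split) auto
      also have "\<dots> \<le> card M * n powr (\<alpha> - 1)"
        using le exps by (intro mult_left_mono powr_mono2) auto
      finally have "4 * (\<rho> + C) * card M powr \<alpha> \<le> 4 * (\<rho> + C) * (card M * n powr (\<alpha> - 1))"
        using \<rho> C by (intro mult_left_mono) auto
      then have 3: "real (edge_count adj M M) \<le> 4 * (\<rho> + C) * (card M * n powr (\<alpha> - 1))"
        using thin_self[OF V(1) M(1)] by linarith
      have "card M * n powr (\<alpha> - 1) \<le> (\<mu> * n) * n powr (\<alpha> - 1)"
        using M by (intro mult_right_mono) auto
      also have "\<dots> = \<mu> * n powr \<alpha>" using powr_split[of n \<alpha>] exps by simp
      finally have "(5 * \<rho> + 4 * C) * (card M * n powr (\<alpha> - 1)) \<le> (5 * \<rho> + 4 * C) * (\<mu> * n powr \<alpha>)"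
        using W by (intro mult_left_mono) auto
      also have "\<dots> = \<kappa> / 2 * n powr \<alpha>" using W by (simp add: \<mu>_def field_simps)
      finally show "real (edge_count adj M V) \<le> \<kappa> * n powr \<alpha>"
        using 1 2 3 elim by (simp add: algebra_simps)
    qed
  qed
  then show ?thesis using \<mu> by blast
qed

definition high_degree :: "'a set \<Rightarrow> ('a \<Rightarrow> 'a \<Rightarrow> bool) \<Rightarrow> bool" where
  "high_degree V adj \<longleftrightarrow> (\<forall>v\<in>V. \<rho> * (2 * real (card V) / 5) powr (\<alpha> - 1) \<le> card {w \<in> V. adj v w})"

text \<open>About \<gamma>n vertices \<open>A'\<close> of \<open>A\<close> have degree sum at least
  |A'| \<rho> (2n/5)^(\<alpha>-1). If |B| < 3n/8, then \<open>B - A'\<close> receives only |A'|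
  \<rho> (3n/8)^(\<alpha>-1) of it up to lower order. As \<open>A'\<close> may overlap
  \<open>B\<close>, the edges inside \<open>A'\<close> are bounded by \<open>thin_self\<close>,
  whose larger constant is harmless for small \<gamma>; a positive share has to leave
  \<open>B\<close>.\<close>

lemma expansion:
  "\<exists>\<gamma>\<^sub>0::real. \<gamma>\<^sub>0 > 0 \<and> (\<forall>\<gamma>::real. 0 < \<gamma> \<and> \<gamma> \<le> \<gamma>\<^sub>0 \<longrightarrow> (\<exists>\<kappa>::real. \<kappa> > 0 \<and> (\<forall>\<^sub>F n in sequentially. \<forall>(V :: 'a set) (adj :: 'a \<Rightarrow> 'a \<Rightarrow> bool).
    thin V adj \<and> card V = n \<and> high_degree V adj \<longrightarrow>
    (\<forall>A B. A \<subseteq> V \<longrightarrow> B \<subseteq> V \<longrightarrow> \<gamma> * n \<le> card A \<longrightarrow> real (edge_count adj A (V - B)) \<le> \<kappa> * n powr \<alpha> \<longrightarrow>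
      3 / 8 * n \<le> real (card B)))))"
proof -
  \<comment> \<open>The gap between the degree density 2/5 and the density 3/8; it is positive since
    \<alpha> > 1.\<close>
  define \<delta> where "\<delta> = \<rho> * ((2 / 5) powr (\<alpha> - 1) - (3 / 8) powr (\<alpha> - 1))"
  have \<delta>: "0 < \<delta>" using \<rho> exps powr_less_mono2[of "\<alpha> - 1" "3 / 8" "2 / 5"] by (simp add: \<delta>_def)
  \<comment> \<open>The bound 3/16 keeps |A'| \<le> 2\<gamma>n below 3n/8, so that
    \<open>thin_bound\<close> applies with q = 3n/8; the other entry makes the edges inside
    \<open>A'\<close> cost at most \<delta>/4.\<close>
  define \<gamma>\<^sub>0 where "\<gamma>\<^sub>0 = min (3 / 16) ((\<delta> / (16 * (\<rho> + C))) powr (1 / (\<alpha> - 1)) / 2)"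
  have \<gamma>\<^sub>0: "0 < \<gamma>\<^sub>0" using \<delta> \<rho> C by (simp add: \<gamma>\<^sub>0_def)
  have \<gamma>\<^sub>0': "4 * (\<rho> + C) * (2 * \<gamma>) powr (\<alpha> - 1) \<le> \<delta> / 4" if "0 < \<gamma>" "\<gamma> \<le> \<gamma>\<^sub>0" for \<gamma> :: real
  proof -
    have "(2 * \<gamma>) powr (\<alpha> - 1) \<le> ((\<delta> / (16 * (\<rho> + C))) powr (1 / (\<alpha> - 1))) powr (\<alpha> - 1)"
      using that exps by (intro powr_mono2) (auto simp: \<gamma>\<^sub>0_def)
    also have "\<dots> = \<delta> / (16 * (\<rho> + C))" using exps \<delta> \<rho> C by (simp add: powr_powr)
    finally show ?thesis using \<rho> C by (simp add: field_simps)
  qed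
  have "\<exists>\<kappa>::real. \<kappa> > 0 \<and> (\<forall>\<^sub>F n in sequentially. \<forall>(V :: 'a set) (adj :: 'a \<Rightarrow> 'a \<Rightarrow> bool).
    thin V adj \<and> card V = n \<and> high_degree V adj \<longrightarrow>
    (\<forall>A B. A \<subseteq> V \<longrightarrow> B \<subseteq> V \<longrightarrow> \<gamma> * n \<le> card A \<longrightarrow> real (edge_count adj A (V - B)) \<le> \<kappa> * n powr \<alpha> \<longrightarrow>
      3 / 8 * n \<le> real (card B)))" if \<gamma>: "0 < \<gamma>" "\<gamma> \<le> \<gamma>\<^sub>0" for \<gamma> :: real
  proof -
    \<comment> \<open>The edges leaving \<open>B\<close> and the error term together cost at most
      2\<kappa>n^\<alpha> = \<delta>\<gamma>n^\<alpha>/2, hence at most \<delta>T/2 for T = |A'|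
      n^(\<alpha>-1), whereas 3\<delta>T/4 has to be accounted for.\<close>
    define \<kappa> where "\<kappa> = \<gamma> * \<delta> / 4"
    have \<kappa>: "0 < \<kappa>" using \<gamma> \<delta> by (simp add: \<kappa>_def)
    have "\<forall>\<^sub>F n in sequentially. C * real n powr \<beta> \<le> \<kappa> * real n powr \<alpha>"
      using exps \<kappa> by (intro eventually_powr_le) auto
    moreover have "\<forall>\<^sub>F n in sequentially. 1 / \<gamma> \<le> real n"
      using filterlim_real_sequentially by (simp add: filterlim_at_top)
    moreover have "\<forall>\<^sub>F n in sequentially. n > (0::nat)" by (rule eventually_gt_at_top)
    ultimately have "\<forall>\<^sub>F n in sequentially. \<forall>(V :: 'a set) (adj :: 'a \<Rightarrow> 'a \<Rightarrow> bool).
      thin V adj \<and> card V = n \<and> high_degree V adj \<longrightarrow>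
      (\<forall>A B. A \<subseteq> V \<longrightarrow> B \<subseteq> V \<longrightarrow> \<gamma> * n \<le> card A \<longrightarrow> real (edge_count adj A (V - B)) \<le> \<kappa> * n powr \<alpha> \<longrightarrow>
        3 / 8 * n \<le> real (card B))"
    proof eventually_elim
      case (elim n)
      show ?case
      proof (intro allI impI, elim conjE, rule ccontr)
        fix V :: "'a set" and adj :: "'a \<Rightarrow> 'a \<Rightarrow> bool" and A B
        assume V: "thin V adj" "card V = n" "high_degree V adj" and A: "A \<subseteq> V" "\<gamma> * n \<le> card A"
          and B: "B \<subseteq> V" "real (edge_count adj A (V - B)) \<le> \<kappa> * n powr \<alpha>"
          and neg: "\<not> 3 / 8 * n \<le> real (card B)"
        have fin: "finite V" "finite A" "finite B" using thinD[OF V(1)] A B finite_subset by blast+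
        have "nat \<lceil>\<gamma> * n\<rceil> \<le> card A" using A by linarith
        then obtain A' where A': "A' \<subseteq> A" "card A' = nat \<lceil>\<gamma> * n\<rceil>" "finite A'"
          using obtain_subset_with_card_n by metis
        have "1 \<le> \<gamma> * n" using elim \<gamma> by (simp add: field_simps)
        then have a: "\<gamma> * n \<le> card A'" "card A' \<le> 2 * \<gamma> * n" "0 < card A'"
          using A'(2) by linarith+
        have A'V: "A' \<subseteq> V" using A A' by auto
        have "2 * \<gamma> * n \<le> 3 / 8 * n" using \<gamma> by (intro mult_right_mono) (auto simp: \<gamma>\<^sub>0_def)
        then have a': "card A' \<le> 3 / 8 * real n" using a by linarith
        have Bc: "card (B - A') \<le> 3 / 8 * real n"
          using neg card_mono[of B "B - A'"] fin by auto
        have split: "(c * n) powr (\<alpha> - 1) = c powr (\<alpha> - 1) * n powr (\<alpha> - 1)" if "0 \<le> c" for c :: real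
          using that by (simp add: powr_mult)
        have lower: "card A' * (\<rho> * (2 / 5) powr (\<alpha> - 1) * n powr (\<alpha> - 1)) \<le> edge_count adj A' V"
          by (rule edge_count_ge_of_degree)
            (use V(2,3) A'V fin A' split[of "2 / 5"] in \<open>auto simp: high_degree_def mult.assoc\<close>)
        have "edge_count adj A' V \<le> edge_count adj A' (V - B \<union> (A' \<union> (B - A')))"
          by (rule edge_count_mono) (use fin A' in auto)
        also have "\<dots> \<le> edge_count adj A' (V - B) + edge_count adj A' (A' \<union> (B - A'))"
          by (rule edge_count_Un_right_le) (use fin A' in auto)
        also have "edge_count adj A' (A' \<union> (B - A')) \<le> edge_count adj A' A' + edge_count adj A' (B - A')"
          by (rule edge_count_Un_right_le) (use fin A' in auto)
        also have "edge_count adj A' (V - B) \<le> edge_count adj A (V - B)"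
          by (rule edge_count_mono) (use fin A' in auto)
        finally have upper: "real (edge_count adj A' V) \<le>
          \<kappa> * n powr \<alpha> + edge_count adj A' A' + edge_count adj A' (B - A')" using B by linarith
        have 1: "real (edge_count adj A' (B - A')) \<le>
          \<rho> * card A' * (3 / 8 * n) powr (\<alpha> - 1) + C * (3 / 8 * n) powr \<beta>"
          by (rule thin_bound[OF V(1)]) (use A'V B a' Bc in auto)
        have 2: "C * (3 / 8 * n) powr \<beta> \<le> C * n powr \<beta>"
          using C exps by (intro mult_left_mono powr_mono2) auto
        have "real (edge_count adj A' A') \<le> 4 * (\<rho> + C) * card A' powr \<alpha>"
          by (rule thin_self[OF V(1) A'V])
        also have "\<dots> = 4 * (\<rho> + C) * (card A' * card A' powr (\<alpha> - 1))"
          using powr_split[of "card A'" \<alpha>] exps by simp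
        also have "\<dots> \<le> 4 * (\<rho> + C) * (card A' * (2 * \<gamma> * n) powr (\<alpha> - 1))"
          using \<rho> C exps a by (intro mult_left_mono powr_mono2) auto
        also have "\<dots> = (4 * (\<rho> + C) * (2 * \<gamma>) powr (\<alpha> - 1)) * (card A' * n powr (\<alpha> - 1))"
          using split[of "2 * \<gamma>"] \<gamma> by simp
        also have "\<dots> \<le> \<delta> / 4 * (card A' * n powr (\<alpha> - 1))"
          using \<gamma>\<^sub>0'[OF \<gamma>] by (intro mult_right_mono) auto
        finally have 3: "real (edge_count adj A' A') \<le> \<delta> / 4 * (card A' * n powr (\<alpha> - 1))" .
        define T where "T = card A' * n powr (\<alpha> - 1)"
        have "(\<gamma> * n) * n powr (\<alpha> - 1) \<le> T"
          unfolding T_def using a by (intro mult_right_mono) auto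
        then have T: "\<gamma> * n powr \<alpha> \<le> T" using powr_split[of n \<alpha>] exps by simp
        have "\<rho> * (2 / 5) powr (\<alpha> - 1) * T \<le>
          \<kappa> * n powr \<alpha> + \<delta> / 4 * T + \<rho> * (3 / 8) powr (\<alpha> - 1) * T + C * n powr \<beta>"
          using lower upper 1 2 3 split[of "3 / 8"] by (simp add: T_def mult_ac)
        then have "\<delta> * T \<le> \<kappa> * n powr \<alpha> + \<delta> / 4 * T + C * n powr \<beta>"
          by (simp add: \<delta>_def algebra_simps)
        also have "\<dots> \<le> 2 * \<kappa> * n powr \<alpha> + \<delta> / 4 * T" using elim by simp
        finally have "3 / 4 * \<delta> * T \<le> 2 * \<kappa> * n powr \<alpha>" by simp
        moreover have "\<delta> * (\<gamma> * n powr \<alpha>) \<le> \<delta> * T" using T \<delta> by (intro mult_left_mono) auto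
        moreover have "\<delta> * (\<gamma> * n powr \<alpha>) = 4 * (\<kappa> * n powr \<alpha>)" by (simp add: \<kappa>_def)
        moreover have "0 < \<kappa> * n powr \<alpha>" using \<kappa> elim by simp
        ultimately show False by linarith
      qed
    qed
    then show ?thesis using \<kappa> by blast
  qed
  then show ?thesis using \<gamma>\<^sub>0 by blast
qed

text \<open>The solution \<eta> of \<beta> - 1 + \<eta>\<beta> = \<alpha> - 1 - \<eta>. For m \<le>
  n it bounds the error (m n^\<eta>)^\<beta> by m n^(\<alpha>-1-\<eta>), which is smaller by
  n^\<eta> than the order m n^(\<alpha>-1) of the degree sum of m vertices.\<close>

definition growth :: real where "growth = (\<alpha> - \<beta>) / (\<beta> + 1)"

lemma growth_pos: "0 < growth"
  using exps by (simp add: growth_def)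

text \<open>\<open>L\<close> is the last level of a tree and \<open>M\<close> all that has been
  used. Every edge at \<open>L\<close> stays in \<open>M\<close> or reaches a new neighbour. Were
  these too few, the density bounds would allow only half of the degree sum of \<open>L\<close>. The
  condition |M| \<le> D |L| makes the count inside \<open>M\<close> proportional to |L|.\<close>

lemma level_growth:
  fixes c D :: real
  assumes "0 < c" "0 < D"
  shows "\<exists>\<nu>::real. \<nu> > 0 \<and> (\<forall>\<^sub>F n in sequentially. \<forall>(V :: 'a set) (adj :: 'a \<Rightarrow> 'a \<Rightarrow> bool).
    thin V adj \<and> card V = n \<and> (\<forall>v\<in>V. c * n powr (\<alpha> - 1) \<le> card {w \<in> V. adj v w}) \<longrightarrow>
    (\<forall>L M. L \<subseteq> M \<longrightarrow> M \<subseteq> V \<longrightarrow> L \<noteq> {} \<longrightarrow> card L \<le> \<nu> * n \<longrightarrow> card M \<le> D * card L \<longrightarrow>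
      min (\<nu> * n) (card L * n powr growth) \<le> card {w \<in> V - M. \<exists>v\<in>L. adj v w}))"
proof -
  \<comment> \<open>\<open>W\<close> adds the coefficients of the main terms inside \<open>M\<close>
    and towards the new vertices; \<nu> brings these terms down to a quarter of the degree sum, and
    the error takes at most another quarter.\<close>
  define W where "W = 4 * (\<rho> + C) * D powr \<alpha> + \<rho>"
  have W: "0 < W" using \<rho> C assms by (simp add: W_def add_pos_pos)
  define \<nu> where "\<nu> = (c / (4 * W)) powr (1 / (\<alpha> - 1))"
  have \<nu>: "0 < \<nu>" "W * \<nu> powr (\<alpha> - 1) = c / 4"
    using W assms exps by (simp_all add: \<nu>_def powr_powr)
  have "\<forall>\<^sub>F n in sequentially. C * real n powr (\<alpha> - 1 - growth) \<le> c / 4 * real n powr (\<alpha> - 1)"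
    using growth_pos assms by (intro eventually_powr_le) auto
  then have "\<forall>\<^sub>F n in sequentially. \<forall>(V :: 'a set) (adj :: 'a \<Rightarrow> 'a \<Rightarrow> bool).
    thin V adj \<and> card V = n \<and> (\<forall>v\<in>V. c * n powr (\<alpha> - 1) \<le> card {w \<in> V. adj v w}) \<longrightarrow>
    (\<forall>L M. L \<subseteq> M \<longrightarrow> M \<subseteq> V \<longrightarrow> L \<noteq> {} \<longrightarrow> card L \<le> \<nu> * n \<longrightarrow> card M \<le> D * card L \<longrightarrow>
      min (\<nu> * n) (card L * n powr growth) \<le> card {w \<in> V - M. \<exists>v\<in>L. adj v w})"
    using eventually_gt_at_top[of 0]
  proof eventually_elim
    case (elim n)
    show ?case
    proof (intro allI impI, elim conjE, rule ccontr)
      fix V :: "'a set" and adj :: "'a \<Rightarrow> 'a \<Rightarrow> bool" and L M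
      define N where "N = {w \<in> V - M. \<exists>v\<in>L. adj v w}"
      assume V: "thin V adj" "card V = n" "\<forall>v\<in>V. c * n powr (\<alpha> - 1) \<le> card {w \<in> V. adj v w}"
        and LM: "L \<subseteq> M" "M \<subseteq> V" "L \<noteq> {}" "card L \<le> \<nu> * n" "card M \<le> D * card L"
        and neg: "\<not> min (\<nu> * n) (card L * n powr growth) \<le> card {w \<in> V - M. \<exists>v\<in>L. adj v w}"
      define q where "q = min (\<nu> * n) (card L * n powr growth)"
      have qN: "card N \<le> q" using neg unfolding N_def q_def by linarith
      have fin: "finite V" "finite M" "finite L" "finite N"
        using thinD[OF V(1)] LM finite_subset[of _ V] by (auto simp: N_def)
      define m where "m = real (card L)"
      have m: "0 < m" "m \<le> n" using fin LM V(2) card_mono[of V L] by (auto simp: m_def card_gt_0_iff)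
      have n: "1 \<le> real n" using elim by simp
      \<comment> \<open>Together with |L| \<le> \<nu>n this gives |L| \<le> q, so that q bounds both
        sets in \<open>thin_bound\<close>.\<close>
      have "1 \<le> n powr growth" using ge_one_powr_ge_zero[OF n] growth_pos by simp
      then have mq: "m \<le> q" using LM(4) m by (simp add: q_def m_def)
      have lower: "m * (c * n powr (\<alpha> - 1)) \<le> edge_count adj L V"
        unfolding m_def by (rule edge_count_ge_of_degree) (use V fin LM in auto)
      have "edge_count adj L V \<le> edge_count adj M M + edge_count adj L N"
        by (rule edge_count_cover_le) (use fin LM in \<open>auto simp: N_def\<close>)
      moreover have "real (edge_count adj M M) \<le> 4 * (\<rho> + C) * D powr \<alpha> * (m * (\<nu> * n) powr (\<alpha> - 1))"
      proof -
        have "card M powr \<alpha> \<le> (D * m) powr \<alpha>" using LM exps by (intro powr_mono2) (auto simp: m_def)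
        also have "\<dots> = D powr \<alpha> * (m * m powr (\<alpha> - 1))"
          using assms m exps powr_split[of m \<alpha>] by (simp add: powr_mult)
        also have "\<dots> \<le> D powr \<alpha> * (m * (\<nu> * n) powr (\<alpha> - 1))"
          using m LM exps by (intro mult_left_mono powr_mono2) (auto simp: m_def)
        finally have "4 * (\<rho> + C) * card M powr \<alpha> \<le> 4 * (\<rho> + C) * (D powr \<alpha> * (m * (\<nu> * n) powr (\<alpha> - 1)))"
          using \<rho> C by (intro mult_left_mono) auto
        then show ?thesis using thin_self[OF V(1) LM(2)] by (simp add: mult_ac)
      qed
      moreover have "real (edge_count adj L N) \<le> \<rho> * (m * (\<nu> * n) powr (\<alpha> - 1)) + C * (m * n powr (\<alpha> - 1 - growth))"
      proof -
        have "real (edge_count adj L N) \<le> \<rho> * card L * q powr (\<alpha> - 1) + C * q powr \<beta>"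
          by (rule thin_bound[OF V(1)]) (use LM mq qN in \<open>auto simp: N_def m_def\<close>)
        also have "\<rho> * card L * q powr (\<alpha> - 1) \<le> \<rho> * card L * (\<nu> * n) powr (\<alpha> - 1)"
          using \<rho> exps m mq by (intro mult_left_mono powr_mono2) (auto simp: q_def)
        also have "C * q powr \<beta> \<le> C * (m * n powr (\<alpha> - 1 - growth))"
        proof -
          have "q powr \<beta> \<le> (m * n powr growth) powr \<beta>"
            using m mq exps by (intro powr_mono2) (auto simp: q_def m_def)
          also have "\<dots> = m * m powr (\<beta> - 1) * n powr (growth * \<beta>)"
            using m exps powr_split[of m \<beta>] by (simp add: powr_mult powr_powr)
          also have "\<dots> \<le> m * n powr (\<beta> - 1) * n powr (growth * \<beta>)"
            using m exps by (intro mult_right_mono mult_left_mono powr_mono2) auto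
          also have "\<dots> = m * n powr (\<beta> - 1 + growth * \<beta>)" by (simp add: powr_add)
          also have "\<beta> - 1 + growth * \<beta> = \<alpha> - 1 - growth" using exps by (simp add: growth_def field_simps)
          finally show ?thesis using C by (rule mult_left_mono)
        qed
        finally show ?thesis by (simp add: m_def mult_ac)
      qed
      ultimately have "m * (c * n powr (\<alpha> - 1)) \<le> W * (m * (\<nu> * n) powr (\<alpha> - 1)) + C * (m * n powr (\<alpha> - 1 - growth))"
        using lower unfolding W_def distrib_right by linarith
      also have "W * (m * (\<nu> * n) powr (\<alpha> - 1)) = m * ((W * \<nu> powr (\<alpha> - 1)) * n powr (\<alpha> - 1))"
        using \<nu> by (simp add: powr_mult)
      also have "\<dots> = m * (c / 4 * n powr (\<alpha> - 1))" using \<nu> by simp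
      finally have "m * (c * n powr (\<alpha> - 1)) \<le> m * (c / 4 * n powr (\<alpha> - 1) + C * n powr (\<alpha> - 1 - growth))"
        by (simp add: algebra_simps)
      then have "c * n powr (\<alpha> - 1) \<le> c / 4 * n powr (\<alpha> - 1) + C * n powr (\<alpha> - 1 - growth)"
        using m by simp
      then have "c * n powr (\<alpha> - 1) \<le> c / 2 * n powr (\<alpha> - 1)" using elim by linarith
      moreover have "0 < c * n powr (\<alpha> - 1)" using assms elim by simp
      ultimately show False by simp
    qed
  qed
  then show ?thesis using \<nu>(1) by blast
qed

end

section \<open>Disjoint trees\<close>

text \<open>Greedy choice: when one subset is picked, the earlier ones occupy at most (|I| - 1) m
  elements, so m remain.\<close>

lemma disjoint_subsets:
  assumes "finite I" "\<And>i. i \<in> I \<Longrightarrow> finite (B i)" "\<And>i. i \<in> I \<Longrightarrow> card I * m \<le> card (B i)"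
  shows "\<exists>L. (\<forall>i\<in>I. L i \<subseteq> B i \<and> card (L i) = m) \<and> (\<forall>i\<in>I. \<forall>j\<in>I. i \<noteq> j \<longrightarrow> L i \<inter> L j = {})"
proof -
  have "\<exists>L. (\<forall>i\<in>J. L i \<subseteq> B i \<and> card (L i) = m) \<and> (\<forall>i\<in>J. \<forall>j\<in>J. i \<noteq> j \<longrightarrow> L i \<inter> L j = {})"
    if "J \<subseteq> I" for J
    using finite_subset[OF that assms(1)] that
  proof (induction J rule: finite_induct)
    case (insert x J)
    then obtain L where L: "\<forall>i\<in>J. L i \<subseteq> B i \<and> card (L i) = m" "\<forall>i\<in>J. \<forall>j\<in>J. i \<noteq> j \<longrightarrow> L i \<inter> L j = {}"
      by auto
    let ?U = "\<Union>i\<in>J. L i"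
    have "finite (L i)" if "i \<in> J" for i
      using L(1) that insert.prems assms(2)[of i] finite_subset[of "L i" "B i"] by auto
    then have finU: "finite ?U" using insert by auto
    have "card ?U \<le> card J * m"
      using card_UN_le[OF insert(1), of L] L by simp
    moreover have "card (insert x J) * m \<le> card I * m"
      by (intro mult_right_mono card_mono assms(1) insert.prems) simp
    moreover have "card I * m \<le> card (B x)" using insert assms(3) by auto
    ultimately have "m \<le> card (B x) - card ?U" using insert by simp
    also have "\<dots> \<le> card (B x - ?U)" by (rule diff_card_le_card_Diff[OF finU])
    finally obtain L' where L': "L' \<subseteq> B x - ?U" "card L' = m"
      using obtain_subset_with_card_n by metis
    show ?case
    proof (intro exI[of _ "L(x := L')"] conjI ballI impI)
      fix i assume "i \<in> insert x J"
      then show "(L(x := L')) i \<subseteq> B i" "card ((L(x := L')) i) = m" using L L' by auto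
    next
      fix i j assume "i \<in> insert x J" "j \<in> insert x J" "i \<noteq> j"
      then show "(L(x := L')) i \<inter> (L(x := L')) j = {}" using L(2) L'(1) by auto
    qed
  qed simp
  then show ?thesis by blast
qed

text \<open>For each root \<open>i \<in> I\<close>, \<open>L i\<close> is the bottom level of a tree of depth \<open>r\<close> with root \<open>i\<close> and
  \<open>M i\<close> the set of its other vertices. All of these sets avoid \<open>U\<close>.\<close>

definition disjoint_trees ::
  "('a \<Rightarrow> 'a \<Rightarrow> bool) \<Rightarrow> 'a set \<Rightarrow> 'a set \<Rightarrow> 'a set \<Rightarrow> nat \<Rightarrow> ('a \<Rightarrow> 'a set) \<Rightarrow> ('a \<Rightarrow> 'a set) \<Rightarrow> bool" where
  "disjoint_trees adj V U I r M L \<longleftrightarrow>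
    (\<forall>i\<in>I. M i \<subseteq> V - U \<and> L i \<subseteq> V - U \<and>
      (\<forall>s\<in>L i. \<exists>p. length p = r \<and> set p \<subseteq> M i \<and> distinct p \<and> successively adj (p @ [s]) \<and> hd (p @ [s]) = i)) \<and>
    (\<forall>i\<in>I. \<forall>j\<in>I. L i \<inter> M j = {} \<and> (i \<noteq> j \<longrightarrow> M i \<inter> M j = {} \<and> L i \<inter> L j = {}))"

lemma disjoint_trees_root:
  "I \<subseteq> V - U \<Longrightarrow> disjoint_trees adj V U I 0 (\<lambda>_. {}) (\<lambda>i. {i})"
  by (auto simp: disjoint_trees_def)

text \<open>The new levels are taken from neighbours outside \<open>U\<close> and all trees. As the
  neighbourhoods of different trees may overlap, each needs room for card I times the wanted size
  before \<open>disjoint_subsets\<close> separates them.\<close>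

lemma disjoint_trees_Suc:
  assumes T: "disjoint_trees adj V U I r M L" and fin: "finite V" "finite I"
    and big: "\<And>i. i \<in> I \<Longrightarrow> card I * m \<le> card {w \<in> V - (U \<union> (\<Union>i\<in>I. M i \<union> L i)). \<exists>v\<in>L i. adj v w}"
  shows "\<exists>L'. disjoint_trees adj V U I (Suc r) (\<lambda>i. M i \<union> L i) L' \<and> (\<forall>i\<in>I. card (L' i) = m)"
proof -
  define B where "B i = {w \<in> V - (U \<union> (\<Union>i\<in>I. M i \<union> L i)). \<exists>v\<in>L i. adj v w}" for i
  have "\<exists>L'. (\<forall>i\<in>I. L' i \<subseteq> B i \<and> card (L' i) = m) \<and> (\<forall>i\<in>I. \<forall>j\<in>I. i \<noteq> j \<longrightarrow> L' i \<inter> L' j = {})"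
    by (rule disjoint_subsets[OF fin(2)]) (use fin big in \<open>auto simp: B_def\<close>)
  then obtain L' where "\<forall>i\<in>I. L' i \<subseteq> B i \<and> card (L' i) = m" "\<forall>i\<in>I. \<forall>j\<in>I. i \<noteq> j \<longrightarrow> L' i \<inter> L' j = {}"
    by (elim exE conjE)
  then have L': "\<And>i. i \<in> I \<Longrightarrow> L' i \<subseteq> B i" "\<And>i. i \<in> I \<Longrightarrow> card (L' i) = m"
    "\<And>i j. i \<in> I \<Longrightarrow> j \<in> I \<Longrightarrow> i \<noteq> j \<Longrightarrow> L' i \<inter> L' j = {}" by simp_all
  have T1: "M i \<subseteq> V - U" "L i \<subseteq> V - U" if "i \<in> I" for i
    using T that by (auto simp: disjoint_trees_def)
  have T2: "\<exists>p. length p = r \<and> set p \<subseteq> M i \<and> distinct p \<and> successively adj (p @ [s]) \<and> hd (p @ [s]) = i"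
    if "i \<in> I" "s \<in> L i" for i s
    using T that by (auto simp: disjoint_trees_def)
  have T3: "L i \<inter> M j = {}" "i \<noteq> j \<Longrightarrow> M i \<inter> M j = {}" "i \<noteq> j \<Longrightarrow> L i \<inter> L j = {}" if "i \<in> I" "j \<in> I" for i j
    using T that by (auto simp: disjoint_trees_def)
  have "disjoint_trees adj V U I (Suc r) (\<lambda>i. M i \<union> L i) L'"
    unfolding disjoint_trees_def
  proof (intro conjI ballI impI)
    fix i assume i: "i \<in> I"
    show "M i \<union> L i \<subseteq> V - U" using T1 i by blast
    show "L' i \<subseteq> V - U" using L'(1)[OF i] by (auto simp: B_def)
    fix s assume "s \<in> L' i"
    then obtain v where v: "v \<in> L i" "adj v s" using L'(1)[OF i] by (auto simp: B_def)
    obtain p where p: "length p = r" "set p \<subseteq> M i" "distinct p" "successively adj (p @ [v])" "hd (p @ [v]) = i"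
      using T2[OF i v(1)] by blast
    have "v \<notin> set p" using T3(1)[OF i i] v p by blast
    then show "\<exists>p. length p = Suc r \<and> set p \<subseteq> M i \<union> L i \<and> distinct p \<and> successively adj (p @ [s]) \<and> hd (p @ [s]) = i"
      using p v by (intro exI[of _ "p @ [v]"]) (auto simp: successively_append_iff hd_append)
  next
    fix i j assume ij: "i \<in> I" "j \<in> I"
    show "L' i \<inter> (M j \<union> L j) = {}" using L'(1)[OF ij(1)] ij by (auto simp: B_def)
    assume "i \<noteq> j"
    then show "(M i \<union> L i) \<inter> (M j \<union> L j) = {}" "L' i \<inter> L' j = {}"
      using T3[OF ij] T3[OF ij(2,1)] L'(3)[OF ij] by auto
  qed
  then show ?thesis using L'(2) by blast
qed

lemma card_levels_le:
  fixes m j R q :: nat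
  assumes "finite I" "card I \<le> q" "\<forall>i\<in>I. card (L i) = m \<and> card (M i) \<le> j * m" "j \<le> R"
  shows "card (\<Union>i\<in>I. M i \<union> L i) \<le> q * (R * m + m)"
proof -
  have "j * m \<le> R * m" using assms(4) by simp
  have "card (M i \<union> L i) \<le> R * m + m" if "i \<in> I" for i
  proof -
    have "card (L i) = m" "card (M i) \<le> j * m" using assms(3) that by auto
    then show ?thesis using card_Un_le[of "M i" "L i"] \<open>j * m \<le> R * m\<close> by linarith
  qed
  then have "(\<Sum>i\<in>I. card (M i \<union> L i)) \<le> card I * (R * m + m)"
    using sum_bounded_above[of I "\<lambda>i. card (M i \<union> L i)" "R * m + m"] by simp
  also have "\<dots> \<le> q * (R * m + m)" using assms(2) by (intro mult_right_mono) auto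
  finally show ?thesis using card_UN_le[OF assms(1), of "\<lambda>i. M i \<union> L i"] by simp
qed

context density_bound
begin

text \<open>All trees grow simultaneously with prescribed level sizes n^(jh), rounded down, for j
  \<le> R; one last jump leads to linear size. Hence the depth is the same for all roots, and the
  vertices above the last level number O(n^(Rh)) = o(n). Depth and leaf density are fixed before
  \<mu>.\<close>

lemma disjoint_trees_exist:
  fixes c :: real
  assumes c: "0 < c"
  shows "\<exists>(r :: nat) \<gamma> :: real. 0 < \<gamma> \<and> (\<forall>\<mu>::real. 0 < \<mu> \<longrightarrow> (\<forall>\<^sub>F n in sequentially. \<forall>(V :: 'a set) (adj :: 'a \<Rightarrow> 'a \<Rightarrow> bool).
    thin V adj \<and> card V = n \<and> (\<forall>v\<in>V. c * n powr (\<alpha> - 1) \<le> card {w \<in> V. adj v w}) \<longrightarrow>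
    (\<forall>I U. I \<subseteq> V - U \<longrightarrow> U \<subseteq> V \<longrightarrow> card I \<le> 3 \<longrightarrow> card U \<le> 1 \<longrightarrow>
      (\<exists>M L. disjoint_trees adj V U I (Suc r) M L \<and> (\<forall>i\<in>I. \<gamma> * n \<le> card (L i)) \<and> card (\<Union>i\<in>I. M i) \<le> \<mu> * n))))"
proof -
  \<comment> \<open>With R > 2/growth the ratio n^h of consecutive levels, h = 1/(R + 1), stays
    below n^growth by a power of n, while (R + 1)h = 1 lets the last level be linear.\<close>
  obtain R :: nat where R: "2 / growth < R" using reals_Archimedean2 by blast
  define h where "h = 1 / real (R + 1)"
  have h: "0 < h" "2 * h < growth" "real R * h + h = 1" "real R * h < 1"
  proof -
    have "2 < R * growth" using R growth_pos by (simp add: field_simps)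
    then have "2 < real (R + 1) * growth" using growth_pos by (simp add: algebra_simps)
    then show "2 * h < growth" by (simp add: h_def field_simps)
    show "0 < h" "real R * h + h = 1" "real R * h < 1" by (simp_all add: h_def field_simps)
  qed
  \<comment> \<open>For level size m, three trees with at most (R + 1)m vertices each and one vertex
    of \<open>U\<close> make 3(R + 1)m + 1 \<le> (3R + 4)m.\<close>
  define D where "D = real (3 * R + 4)"
  obtain \<nu>' :: real where \<nu>': "0 < \<nu>'" "\<forall>\<^sub>F n in sequentially. \<forall>(V :: 'a set) (adj :: 'a \<Rightarrow> 'a \<Rightarrow> bool).
    thin V adj \<and> card V = n \<and> (\<forall>v\<in>V. c * n powr (\<alpha> - 1) \<le> card {w \<in> V. adj v w}) \<longrightarrow>
    (\<forall>L M. L \<subseteq> M \<longrightarrow> M \<subseteq> V \<longrightarrow> L \<noteq> {} \<longrightarrow> card L \<le> \<nu>' * n \<longrightarrow> card M \<le> D * card L \<longrightarrow>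
      min (\<nu>' * n) (card L * n powr growth) \<le> card {w \<in> V - M. \<exists>v\<in>L. adj v w})"
    using level_growth[OF c, of D] by (auto simp: D_def)
  define \<nu> where "\<nu> = min \<nu>' 1"
  have \<nu>: "0 < \<nu>" "\<nu> \<le> \<nu>'" "\<nu> \<le> 1" using \<nu>' by (auto simp: \<nu>_def)
  have "\<forall>\<^sub>F n in sequentially. \<forall>(V :: 'a set) (adj :: 'a \<Rightarrow> 'a \<Rightarrow> bool).
    thin V adj \<and> card V = n \<and> (\<forall>v\<in>V. c * n powr (\<alpha> - 1) \<le> card {w \<in> V. adj v w}) \<longrightarrow>
    (\<forall>I U. I \<subseteq> V - U \<longrightarrow> U \<subseteq> V \<longrightarrow> card I \<le> 3 \<longrightarrow> card U \<le> 1 \<longrightarrow>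
      (\<exists>M L. disjoint_trees adj V U I (Suc R) M L \<and> (\<forall>i\<in>I. \<nu> / 6 * n \<le> card (L i)) \<and> card (\<Union>i\<in>I. M i) \<le> \<mu> * n))"
    if \<mu>: "0 < \<mu>" for \<mu> :: real
  proof -
    have "\<forall>\<^sub>F n in sequentially. 1 * real n powr (R * h) \<le> \<nu> / 3 * real n powr 1"
      using \<nu> h by (intro eventually_powr_le) auto
    moreover have "\<forall>\<^sub>F n in sequentially. real (3 * (R + 1)) * real n powr (R * h) \<le> \<mu> * real n powr 1"
      using \<mu> h by (intro eventually_powr_le) auto
    moreover have "\<forall>\<^sub>F n in sequentially. 6 * real n powr h \<le> 1 * real n powr growth"
      using h by (intro eventually_powr_le) auto
    moreover have "\<forall>\<^sub>F n in sequentially. n > (0::nat)" by (rule eventually_gt_at_top)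
    ultimately show ?thesis using \<nu>'(2)
    proof eventually_elim
      case (elim n)
      have n: "1 \<le> real n" using elim(4) by simp
      define m where "m j = nat \<lfloor>real n powr (j * h)\<rfloor>" for j :: nat
      have pow_mono: "real n powr (j * h) \<le> real n powr (j' * h)" if "j \<le> j'" for j j' :: nat
        using that n h by (intro powr_mono mult_right_mono) auto
      have pow_ge: "1 \<le> real n powr (j * h)" for j :: nat using pow_mono[of 0 j] n by simp
      have m: "real (m j) \<le> real n powr (j * h)" "real n powr (j * h) \<le> 2 * m j" "1 \<le> m j" for j
      proof -
        have "1 \<le> \<lfloor>real n powr (j * h)\<rfloor>" using pow_ge[of j] by (simp add: le_floor_iff)
        then have "real (m j) = \<lfloor>real n powr (j * h)\<rfloor>" "1 \<le> m j"
          unfolding m_def by linarith+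
        then show "real (m j) \<le> real n powr (j * h)" "real n powr (j * h) \<le> 2 * m j" "1 \<le> m j"
          by linarith+
      qed
      have m_mono: "m j \<le> m (Suc j)" for j
        using pow_mono[of j "Suc j"] by (auto simp: m_def intro!: nat_mono floor_mono)
      have m_le: "3 * real (m j) \<le> \<nu> * n" if "j \<le> R" for j
        using m(1)[of j] pow_mono[OF that] elim(1) n by simp
      show ?case
      proof (intro allI impI, elim conjE)
        fix V :: "'a set" and adj :: "'a \<Rightarrow> 'a \<Rightarrow> bool" and I U
        assume V: "thin V adj" "card V = n" and deg: "\<forall>v\<in>V. c * n powr (\<alpha> - 1) \<le> card {w \<in> V. adj v w}"
          and I: "I \<subseteq> V - U" "card I \<le> 3" and U: "U \<subseteq> V" "card U \<le> 1"
        have fin: "finite V" "finite I" "finite U" using thinD(1)[OF V(1)] I U finite_subset by blast+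
        \<comment> \<open>One more level of variable target size m', which serves both for the
          powers of n and for the final linear size. The factor 3 bounds the number of roots sharing
          the new vertices.\<close>
        have grow: "\<exists>L'. disjoint_trees adj V U I (Suc j) (\<lambda>i. M i \<union> L i) L' \<and> (\<forall>i\<in>I. card (L' i) = m')"
          if "j \<le> R" and T: "disjoint_trees adj V U I j M L" "\<forall>i\<in>I. card (L i) = m j \<and> card (M i) \<le> j * m j"
            and m': "3 * real m' \<le> \<nu> * n" "3 * real m' \<le> 3 * n powr ((j + 1) * h)" for j M L m'
        proof (rule disjoint_trees_Suc[OF T(1) fin(1,2)])
          fix i assume i: "i \<in> I"
          define W where "W = U \<union> (\<Union>i\<in>I. M i \<union> L i)"
          have sub: "M i \<union> L i \<subseteq> V" if "i \<in> I" for i using T(1) that by (auto simp: disjoint_trees_def)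
          have W: "L i \<subseteq> W" "W \<subseteq> V" using i sub U by (auto simp: W_def)
          have "card (\<Union>i\<in>I. M i \<union> L i) \<le> 3 * (R * m j + m j)"
            by (rule card_levels_le) (use fin I T(2) \<open>j \<le> R\<close> in auto)
          then have "card W \<le> 1 + 3 * (R * m j + m j)"
            using card_Un_le[of U "\<Union>i\<in>I. M i \<union> L i"] U by (simp add: W_def)
          also have "\<dots> \<le> (3 * R + 4) * m j" using m(3)[of j] by (simp add: algebra_simps)
          finally have "real (card W) \<le> real ((3 * R + 4) * m j)" by (simp only: of_nat_le_iff)
          then have cardW: "real (card W) \<le> D * card (L i)" using T(2) i by (simp add: D_def)
          have "card (L i) = m j" using T(2) i by simp
          moreover have "3 * real m' \<le> \<nu>' * n" "real (m j) \<le> \<nu>' * n"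
            using m' m_le[OF \<open>j \<le> R\<close>] mult_right_mono[OF \<nu>(2), of n] by auto
          moreover have "3 * real m' \<le> m j * n powr growth"
          proof -
            have "3 * real m' \<le> 3 * (n powr (j * h) * n powr h)"
              using m'(2) by (simp add: powr_add algebra_simps)
            also have "\<dots> \<le> 3 * ((2 * m j) * n powr h)" using m(2)[of j] by (intro mult_left_mono mult_right_mono) auto
            \<comment> \<open>The 6 is 3 for the roots times 2 for rounding the level size
              down.\<close>
            also have "\<dots> = m j * (6 * n powr h)" by simp
            also have "\<dots> \<le> m j * n powr growth" using elim(3) by (intro mult_left_mono) auto
            finally show ?thesis .
          qed
          moreover have "L i \<noteq> {}" using \<open>card (L i) = m j\<close> m(3)[of j] by auto
          ultimately have "3 * real m' \<le> card {w \<in> V - W. \<exists>v\<in>L i. adj v w}"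
            using elim(5)[rule_format, OF _ W, of adj] V deg cardW by fastforce
          then have "3 * m' \<le> card {w \<in> V - W. \<exists>v\<in>L i. adj v w}" by linarith
          moreover have "card I * m' \<le> 3 * m'" using I by (intro mult_right_mono) auto
          ultimately show "card I * m' \<le> card {w \<in> V - (U \<union> (\<Union>i\<in>I. M i \<union> L i)). \<exists>v\<in>L i. adj v w}"
            unfolding W_def by (rule order_trans[rotated])
        qed
        have "\<exists>M L. disjoint_trees adj V U I j M L \<and> (\<forall>i\<in>I. card (L i) = m j \<and> card (M i) \<le> j * m j)"
          if "j \<le> R" for j
          using that
        proof (induction j)
          case 0
          have "m 0 = 1" using n by (simp add: m_def)
          then show ?case using disjoint_trees_root[OF I(1), of adj] by (intro exI conjI) auto
        next
          case (Suc j)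
          then obtain M L where T: "disjoint_trees adj V U I j M L" "\<forall>i\<in>I. card (L i) = m j \<and> card (M i) \<le> j * m j"
            by auto
          obtain L' where L': "disjoint_trees adj V U I (Suc j) (\<lambda>i. M i \<union> L i) L'" "\<forall>i\<in>I. card (L' i) = m (Suc j)"
            using grow[OF _ T, of "m (Suc j)"] Suc.prems m_le[OF Suc.prems] m(1)[of "Suc j"] by (auto simp: algebra_simps)
          have "card (M i \<union> L i) \<le> Suc j * m (Suc j)" if "i \<in> I" for i
          proof -
            have "card (M i \<union> L i) \<le> j * m j + m j" using card_Un_le[of "M i" "L i"] T(2) that by fastforce
            also have "\<dots> = Suc j * m j" by simp
            also have "\<dots> \<le> Suc j * m (Suc j)" using m_mono by (intro mult_left_mono) auto
            finally show ?thesis .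
          qed
          then show ?case using L' by (intro exI[of _ "\<lambda>i. M i \<union> L i"] exI[of _ L']) auto
        qed
        from this[of R] obtain M L where
          T: "disjoint_trees adj V U I R M L" "\<forall>i\<in>I. card (L i) = m R \<and> card (M i) \<le> R * m R" by auto
        \<comment> \<open>The last level takes a third of \<nu>n for each of up to three roots;
          after rounding at least \<nu>n/6 is left, as \<nu>n/3 \<ge> 1.\<close>
        define m' where "m' = nat \<lfloor>\<nu> * n / 3\<rfloor>"
        have "(real R + 1) * h = 1" by (simp add: h_def)
        then have pow1: "n powr ((real R + 1) * h) = n" using n by simp
        have "\<nu> * n \<le> 1 * n" "0 \<le> \<nu> * n" using \<nu> mult_right_mono[OF \<nu>(3), of n] by simp_all
        then have "3 * real m' \<le> \<nu> * n" "3 * real m' \<le> 3 * n powr ((real R + 1) * h)"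
          unfolding m'_def pow1 by linarith+
        then obtain L' where L': "disjoint_trees adj V U I (Suc R) (\<lambda>i. M i \<union> L i) L'" "\<forall>i\<in>I. card (L' i) = m'"
          using grow[OF order_refl T, of m'] by blast
        have "1 \<le> \<nu> * n / 3" using elim(1) pow_ge[of R] n by simp
        then have "1 \<le> \<lfloor>\<nu> * n / 3\<rfloor>" by linarith
        then have m'_ge: "\<nu> / 6 * n \<le> m'" unfolding m'_def by linarith
        have "card (\<Union>i\<in>I. M i \<union> L i) \<le> 3 * (R * m R + m R)"
          by (rule card_levels_le) (use fin I T(2) in auto)
        then have "real (card (\<Union>i\<in>I. M i \<union> L i)) \<le> real (3 * (R + 1) * m R)"
          by (simp only: of_nat_le_iff) (simp add: algebra_simps)
        also have "\<dots> \<le> real (3 * (R + 1)) * n powr (R * h)"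
          using m(1)[of R] by (simp only: of_nat_mult) (intro mult_left_mono, auto)
        also have "\<dots> \<le> \<mu> * n" using elim(2) n by simp
        finally show "\<exists>M L. disjoint_trees adj V U I (Suc R) M L \<and> (\<forall>i\<in>I. \<nu> / 6 * n \<le> card (L i)) \<and>
            card (\<Union>i\<in>I. M i) \<le> \<mu> * n"
          using L' m'_ge by (intro exI[of _ "\<lambda>i. M i \<union> L i"] exI[of _ L']) auto
      qed
    qed
  qed
  then show ?thesis using \<nu>(1) by (intro exI[of _ R] exI[of _ "\<nu> / 6"] conjI allI impI) simp_all
qed

end

section \<open>Odd cycles\<close>

definition has_cycle :: "('a \<Rightarrow> 'a \<Rightarrow> bool) \<Rightarrow> 'a set \<Rightarrow> nat \<Rightarrow> bool" where
  "has_cycle adj V k \<longleftrightarrow> (\<exists>p. length p = k \<and> p \<noteq> [] \<and> distinct p \<and> set p \<subseteq> V \<and> successively adj p \<and> adj (last p) (hd p))"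

lemma successively_rev_symp:
  assumes "symp adj"
  shows "successively adj (rev p) \<longleftrightarrow> successively adj p"
proof -
  have "(\<lambda>x y. adj y x) = adj" using assms by (auto simp: fun_eq_iff symp_def)
  then show ?thesis unfolding successively_rev by (rule arg_cong)
qed

text \<open>\<open>P\<close> leads from one root to the meeting vertex, \<open>Q\<close> from the
  other root to the vertex before it, and \<open>c\<close> links the roots. The cycle is
  \<open>P\<close>, reversed \<open>Q\<close>, \<open>c\<close>; leaving the meeting vertex out of
  \<open>Q\<close> counts it once.\<close>

lemma has_cycle_join:
  assumes "symp adj" and P: "P \<noteq> []" "successively adj P"
    and Q: "Q \<noteq> []" "successively adj (Q @ [last P])"
    and c: "successively adj (hd Q # c @ [hd P])"
    and "distinct (P @ Q @ c)" "set (P @ Q @ c) \<subseteq> V"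
  shows "has_cycle adj V (length P + length Q + length c)"
proof -
  note rev = successively_rev_symp[OF assms(1)]
  have "adj (last P) (last Q)" "successively adj Q"
    using Q assms(1) by (auto simp: successively_append_iff symp_def)
  then have "successively adj (P @ rev Q @ c)"
    using P Q c by (cases c) (auto simp: successively_append_iff rev hd_rev last_rev successively_Cons hd_append simp del: successively_rev split: if_splits)
  moreover have "adj (last (P @ rev Q @ c)) (hd (P @ rev Q @ c))"
    using P Q c by (auto simp: successively_append_iff last_rev last_append successively_Cons)
  ultimately show ?thesis
    unfolding has_cycle_def using assms by (intro exI[of _ "P @ rev Q @ c"]) auto
qed

lemma disjoint_trees_path:
  assumes "disjoint_trees adj V U I r M L" "i \<in> I" "s \<in> L i"
  obtains p where "length p = r" "set p \<subseteq> M i" "distinct p" "successively adj (p @ [s])" "hd (p @ [s]) = i"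
  using assms unfolding disjoint_trees_def by fast

text \<open>The cycle consists of two tree paths with Suc r vertices each, two robust paths with t +
  1 and t' + 1 vertices sharing \<open>w\<close>, and the link \<open>c\<close> inside
  \<open>U\<close>. The robust paths run outside \<open>U\<close> and the sets \<open>M i\<close>,
  so the parts are disjoint. Trees and robust paths have separate relations because the two
  applications restrict them differently.\<close>

lemma has_cycle_of_disjoint_trees:
  assumes V: "finite V" and adj: "symp adj" and T: "disjoint_trees H V U I (Suc r) M L"
    and sub: "\<And>u v. H u v \<Longrightarrow> adj u v" "\<And>u v. adj' u v \<Longrightarrow> adj u v"
    and xy: "x \<in> I" "y \<in> I" "x \<noteq> y"
    and w: "w \<in> (robust_nbhd adj' (V - (U \<union> (\<Union>i\<in>I. M i))) K ^^ t) (L x)"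
      "w \<in> (robust_nbhd adj' (V - (U \<union> (\<Union>i\<in>I. M i))) K ^^ t') (L y)"
    and K: "t + t' + 1 < K"
    and c: "successively adj (y # c @ [x])" "distinct c" "set c \<subseteq> U" "U \<subseteq> V"
  shows "has_cycle adj V (2 * Suc r + t + t' + 1 + length c)"
proof -
  let ?V = "V - (U \<union> (\<Union>i\<in>I. M i))"
  have T1: "M i \<subseteq> V - U" "L i \<subseteq> ?V" if "i \<in> I" for i
    using T that unfolding disjoint_trees_def by blast+
  have T3: "M x \<inter> M y = {}" using T xy by (auto simp: disjoint_trees_def)
  have finV: "finite ?V" using V by auto
  obtain q1 where q1: "length q1 = Suc t" "hd q1 = w" "last q1 \<in> L x" "distinct q1" "successively adj' q1" "set q1 \<subseteq> ?V"
    using robust_path[OF finV w(1) T1(2)[OF xy(1)], of "{}"] K by auto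
  \<comment> \<open>The second path has to avoid these t + 1 vertices during t' steps, whence t + t'
    + 1 < K; its start \<open>w\<close> is exempt.\<close>
  have "card (set q1) = Suc t" using q1 distinct_card by fastforce
  then obtain q2 where q2: "length q2 = Suc t'" "hd q2 = w" "last q2 \<in> L y" "distinct q2" "successively adj' q2"
    "set q2 \<subseteq> ?V" "set (tl q2) \<inter> set q1 = {}"
    using robust_path[OF finV w(2) T1(2)[OF xy(2)], of "set q1"] K by auto
  obtain p1 where p1: "length p1 = Suc r" "set p1 \<subseteq> M x" "distinct p1" "successively H (p1 @ [last q1])" "hd (p1 @ [last q1]) = x"
    using disjoint_trees_path[OF T xy(1) q1(3)] by blast
  obtain p2 where p2: "length p2 = Suc r" "set p2 \<subseteq> M y" "distinct p2" "successively H (p2 @ [last q2])" "hd (p2 @ [last q2]) = y"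
    using disjoint_trees_path[OF T xy(2) q2(3)] by blast
  note rev = successively_rev_symp[OF adj]
  have ne: "q1 \<noteq> []" "q2 \<noteq> []" "p1 \<noteq> []" "p2 \<noteq> []" using q1(1) q2(1) p1(1) p2(1) by auto
  have q2': "q2 = w # tl q2" using q2(2) ne by (cases q2) auto
  have path: "successively adj (p @ rev q)" if "successively H (p @ [last q])" "successively adj' q" "q \<noteq> []" for p q
  proof -
    have "successively adj (p @ [last q])" "successively adj q"
      using that(1,2) sub by (blast intro: successively_mono)+
    then show ?thesis using that(3)
      by (auto simp: successively_append_iff rev hd_rev simp del: successively_rev)
  qed
  have 1: "successively adj (p1 @ rev q1)" by (rule path) (use p1 q1 ne in auto)
  have "successively adj (p2 @ rev q2)" by (rule path) (use p2 q2 ne in auto)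
  then have 2: "successively adj ((p2 @ rev (tl q2)) @ [w])" by (subst (asm) q2') simp
  have lw: "last (p1 @ rev q1) = w" using ne q1 by (simp add: last_rev)
  have hds: "hd (p2 @ rev (tl q2)) = y" "hd (p1 @ rev q1) = x" using p1(5) p2(5) ne by auto
  have sets: "set (tl q2) \<subseteq> ?V" using q2(6) ne by (meson list.set_sel(2) subset_code(1) subset_iff)
  have "has_cycle adj V (length (p1 @ rev q1) + length (p2 @ rev (tl q2)) + length c)"
  proof (rule has_cycle_join[OF adj])
    have "set p1 \<inter> set q1 = {}" "set p1 \<inter> set p2 = {}" "set p2 \<inter> set q1 = {}" "set p1 \<inter> set (tl q2) = {}"
      "set p2 \<inter> set (tl q2) = {}" using p1(2) p2(2) q1(6) sets T3 xy by blast+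
    moreover have "set c \<inter> set p1 = {}" "set c \<inter> set p2 = {}" "set c \<inter> set q1 = {}" "set c \<inter> set (tl q2) = {}"
      using c(3) p1(2) p2(2) q1(6) sets T1(1) xy by blast+
    moreover have "distinct (tl q2)" using q2(4) by (rule distinct_tl)
    ultimately show "distinct ((p1 @ rev q1) @ (p2 @ rev (tl q2)) @ c)"
      using p1(3) p2(3) q1(4) q2(7) c(2) by auto
    show "set ((p1 @ rev q1) @ (p2 @ rev (tl q2)) @ c) \<subseteq> V"
      using p1(2) p2(2) q1(6) sets T1(1)[OF xy(1)] T1(1)[OF xy(2)] c(3,4) by auto
  qed (use ne 1 2 lw hds c in auto)
  moreover have "length (p1 @ rev q1) + length (p2 @ rev (tl q2)) + length c = 2 * Suc r + t + t' + 1 + length c"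
    using p1(1) p2(1) q1(1) q2(1) by simp
  ultimately show ?thesis by (simp only:)
qed

section \<open>The nearly bipartite case\<close>

lemma alternating_side:
  assumes "successively H p" "p \<noteq> []" "\<And>u v. H u v \<Longrightarrow> u \<in> X \<longleftrightarrow> v \<notin> X"
  shows "last p \<in> X \<longleftrightarrow> (hd p \<in> X \<longleftrightarrow> odd (length p))"
  using assms(1,2)
proof (induction p rule: induct_list012)
  case (3 u v p)
  then show ?case using assms(3)[of u v] by auto
qed auto

text \<open>As K > 0, every vertex of an iterate has a neighbour in the preceding one, and a
  crossing edge changes the side.\<close>

lemma robust_iterate_side:
  assumes "\<And>u v. H u v \<Longrightarrow> u \<in> X \<longleftrightarrow> v \<notin> X" "0 < K" "\<And>v. v \<in> S \<Longrightarrow> v \<in> X \<longleftrightarrow> b"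
    and "v \<in> (robust_nbhd H V K ^^ t) S"
  shows "v \<in> X \<longleftrightarrow> (b \<longleftrightarrow> even t)"
  using assms(4)
proof (induction t arbitrary: v)
  case (Suc t)
  then have "0 < card {a \<in> (robust_nbhd H V K ^^ t) S. H v a}"
    using assms(2) by (simp add: mem_robust_nbhd)
  then have "{a \<in> (robust_nbhd H V K ^^ t) S. H v a} \<noteq> {}" by force
  then obtain a where "a \<in> (robust_nbhd H V K ^^ t) S" "H v a" by blast
  then show ?case using Suc.IH[of a] assms(1)[of v a] by auto
qed (use assms in auto)

context density_bound
begin

text \<open>A maximum cut has no more inner edges than the given one. For an inner edge uv, equally
  long iterates of the two leaf levels lie on one side, while the next iterate takes 3n/8 vertices
  of the other; so the first two meet. The edge uv closes a cycle of odd length 2(r + 1) + 2t +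
  1.\<close>

lemma bipartite_if_near_bipartite:
  "\<exists>\<kappa>::real. 0 < \<kappa> \<and> (\<exists>k\<^sub>0. \<forall>k\<ge>k\<^sub>0. odd k \<longrightarrow> (\<forall>\<^sub>F n in sequentially. \<forall>(V :: 'a set) (adj :: 'a \<Rightarrow> 'a \<Rightarrow> bool).
    thin V adj \<and> card V = n \<and> high_degree V adj \<and> \<not> has_cycle adj V k \<and>
    (\<exists>X\<subseteq>V. real (inner_edges adj V X) \<le> \<kappa> * n powr \<alpha>) \<longrightarrow>
    (\<exists>X\<subseteq>V. \<forall>u\<in>V. \<forall>v\<in>V. adj u v \<longrightarrow> (u \<in> X \<longleftrightarrow> v \<notin> X))))"
proof -
  \<comment> \<open>Half of the minimum degree density, since every vertex keeps at least half of
    its degree across the cut.\<close>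
  define c where "c = \<rho> * (2 / 5) powr (\<alpha> - 1) / 2"
  have c: "0 < c" using \<rho> by (simp add: c_def)
  obtain r and \<gamma>\<^sub>1 :: real where trees: "0 < \<gamma>\<^sub>1" "\<And>\<mu>::real. 0 < \<mu> \<Longrightarrow>
    (\<forall>\<^sub>F n in sequentially. \<forall>(V :: 'a set) (adj :: 'a \<Rightarrow> 'a \<Rightarrow> bool).
    thin V adj \<and> card V = n \<and> (\<forall>v\<in>V. c * n powr (\<alpha> - 1) \<le> card {w \<in> V. adj v w}) \<longrightarrow>
    (\<forall>I U. I \<subseteq> V - U \<longrightarrow> U \<subseteq> V \<longrightarrow> card I \<le> 3 \<longrightarrow> card U \<le> 1 \<longrightarrow>
      (\<exists>M L. disjoint_trees adj V U I (Suc r) M L \<and> (\<forall>i\<in>I. \<gamma>\<^sub>1 * n \<le> card (L i)) \<and> card (\<Union>i\<in>I. M i) \<le> \<mu> * n)))"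
    using disjoint_trees_exist[OF c, where ?'a = 'a] by blast
  obtain \<gamma>\<^sub>0 :: real where \<gamma>\<^sub>0: "0 < \<gamma>\<^sub>0" "\<And>\<gamma>::real. 0 < \<gamma> \<and> \<gamma> \<le> \<gamma>\<^sub>0 \<Longrightarrow>
    (\<exists>\<kappa>::real. \<kappa> > 0 \<and> (\<forall>\<^sub>F n in sequentially. \<forall>(V :: 'a set) (adj :: 'a \<Rightarrow> 'a \<Rightarrow> bool).
    thin V adj \<and> card V = n \<and> high_degree V adj \<longrightarrow>
    (\<forall>A B. A \<subseteq> V \<longrightarrow> B \<subseteq> V \<longrightarrow> \<gamma> * n \<le> card A \<longrightarrow> real (edge_count adj A (V - B)) \<le> \<kappa> * n powr \<alpha> \<longrightarrow>
      3 / 8 * n \<le> real (card B))))"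
    using expansion[where ?'a = 'a] by blast
  define \<gamma> where "\<gamma> = min (min \<gamma>\<^sub>1 \<gamma>\<^sub>0) (1 / 100)"
  have \<gamma>: "0 < \<gamma>" "\<gamma> \<le> \<gamma>\<^sub>0" "\<gamma> \<le> \<gamma>\<^sub>1" "\<gamma> \<le> 1 / 100" using trees(1) \<gamma>\<^sub>0(1) by (auto simp: \<gamma>_def)
  obtain \<kappa>' :: real where \<kappa>': "0 < \<kappa>'" "\<forall>\<^sub>F n in sequentially. \<forall>(V :: 'a set) (adj :: 'a \<Rightarrow> 'a \<Rightarrow> bool).
    thin V adj \<and> card V = n \<and> high_degree V adj \<longrightarrow>
    (\<forall>A B. A \<subseteq> V \<longrightarrow> B \<subseteq> V \<longrightarrow> \<gamma> * n \<le> card A \<longrightarrow> real (edge_count adj A (V - B)) \<le> \<kappa>' * n powr \<alpha> \<longrightarrow>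
      3 / 8 * n \<le> real (card B))"
    using \<gamma>\<^sub>0(2)[of \<gamma>] \<gamma> by blast
  \<comment> \<open>Three losses of \<kappa>n^\<alpha> must fit into \<open>expansion\<close>: the
    edges at the tree vertices, those inside the sides of the cut, and the K n edges that a robust
    neighbourhood misses.\<close>
  define \<kappa> where "\<kappa> = \<kappa>' / 4"
  have \<kappa>: "0 < \<kappa>" using \<kappa>' by (simp add: \<kappa>_def)
  obtain \<mu> :: real where \<mu>: "0 < \<mu>" "\<forall>\<^sub>F n in sequentially. \<forall>(V :: 'a set) (adj :: 'a \<Rightarrow> 'a \<Rightarrow> bool).
    thin V adj \<and> card V = n \<longrightarrow>
    (\<forall>M\<subseteq>V. card M \<le> \<mu> * n \<longrightarrow> real (edge_count adj M V) \<le> \<kappa> * n powr \<alpha>)"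
    using small_set[OF \<kappa>, where ?'a = 'a] by blast
  have "\<forall>\<^sub>F n in sequentially. \<forall>(V :: 'a set) (adj :: 'a \<Rightarrow> 'a \<Rightarrow> bool).
    thin V adj \<and> card V = n \<and> high_degree V adj \<and> \<not> has_cycle adj V k \<and>
    (\<exists>X\<subseteq>V. real (inner_edges adj V X) \<le> \<kappa> * n powr \<alpha>) \<longrightarrow>
    (\<exists>X\<subseteq>V. \<forall>u\<in>V. \<forall>v\<in>V. adj u v \<longrightarrow> (u \<in> X \<longleftrightarrow> v \<notin> X))"
    if k: "k \<ge> 2 * Suc r + 3" "odd k" for k
  proof -
    \<comment> \<open>The division is exact as k is odd. The lower bound on k gives t > 0, so that
      at least one expansion step takes place.\<close>
    define t where "t = (k - 2 * Suc r - 1) div 2"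
    have t: "k = 2 * Suc r + t + t + 1" "0 < t" using k unfolding t_def by presburger+
    define K where "K = k + 1"
    have "\<forall>\<^sub>F n in sequentially. real K * real n powr 1 \<le> \<kappa> * real n powr \<alpha>"
      using exps \<kappa> by (intro eventually_powr_le) auto
    moreover have "\<forall>\<^sub>F n in sequentially. n > (0::nat)" by (rule eventually_gt_at_top)
    ultimately show ?thesis using trees(2)[OF \<mu>(1)] \<kappa>'(2) \<mu>(2)
    proof eventually_elim
      case (elim n)
      show ?case
      proof (intro allI impI, elim conjE exE)
        fix V :: "'a set" and adj :: "'a \<Rightarrow> 'a \<Rightarrow> bool" and X\<^sub>0
        assume V: "thin V adj" "card V = n" "high_degree V adj" and no_cycle: "\<not> has_cycle adj V k"
          and X\<^sub>0: "X\<^sub>0 \<subseteq> V" "real (inner_edges adj V X\<^sub>0) \<le> \<kappa> * n powr \<alpha>"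
        note basic = thinD[OF V(1)]
        obtain X where X: "X \<subseteq> V" "\<And>X'. X' \<subseteq> V \<Longrightarrow> inner_edges adj V X \<le> inner_edges adj V X'"
          and half: "\<And>v. v \<in> V \<Longrightarrow> card {w \<in> V. adj v w} \<le> 2 * card {w \<in> V. adj v w \<and> (v \<in> X \<longleftrightarrow> w \<notin> X)}"
          by (rule max_cut_exists[OF basic]) blast
        have inner: "real (inner_edges adj V X) \<le> \<kappa> * n powr \<alpha>" using X(2)[OF X\<^sub>0(1)] X\<^sub>0(2) by linarith
        have "u \<in> X \<longleftrightarrow> v \<notin> X" if uv: "u \<in> V" "v \<in> V" "adj u v" for u v
        proof (rule ccontr)
          assume same: "\<not> (u \<in> X \<longleftrightarrow> v \<notin> X)"
          have "u \<noteq> v" using uv basic(3) by (auto simp: irreflp_def)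
          define H where "H a b \<longleftrightarrow> adj a b \<and> (a \<in> X \<longleftrightarrow> b \<notin> X)" for a b
          have H: "adj a b" "a \<in> X \<longleftrightarrow> b \<notin> X" if "H a b" for a b using that by (auto simp: H_def)
          have symH: "symp H" using basic(2) by (auto simp: H_def symp_def)
          have thinH: "thin V H" by (rule thin_mono[OF V(1) order_refl _ symH]) (rule H)
          have "c * n powr (\<alpha> - 1) \<le> card {w \<in> V. H a w}" if "a \<in> V" for a
          proof -
            have "\<rho> * (2 / 5 * n) powr (\<alpha> - 1) \<le> card {w \<in> V. adj a w}"
              using V that by (auto simp: high_degree_def)
            then have "2 * (c * n powr (\<alpha> - 1)) \<le> card {w \<in> V. adj a w}"
              by (simp only: powr_mult) (simp add: c_def powr_mult)
            then show ?thesis using half[OF that] by (simp add: H_def)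
          qed
          moreover have "card {u, v} \<le> 3" "{u, v} \<subseteq> V - {}" using uv by (auto simp: card_insert_if)
          ultimately obtain M L where T: "disjoint_trees H V {} {u, v} (Suc r) M L"
            and L: "\<forall>i\<in>{u, v}. \<gamma>\<^sub>1 * n \<le> card (L i)" and M: "card (\<Union>i\<in>{u, v}. M i) \<le> \<mu> * n"
            using elim(3)[rule_format, of V H "{u, v}" "{}"] thinH V(2) by auto
          define Z where "Z = {} \<union> (\<Union>i\<in>{u, v}. M i)"
          have MLV: "M i \<subseteq> V" "L i \<subseteq> V - Z" if "i \<in> {u, v}" for i
            using T that unfolding disjoint_trees_def Z_def by blast+
          have ZV: "Z \<subseteq> V" using MLV by (auto simp: Z_def)
          have Zedges: "real (edge_count adj Z V) \<le> \<kappa> * n powr \<alpha>"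
            using elim(5) V ZV M by (auto simp: Z_def)
          define \<Gamma> where "\<Gamma> = robust_nbhd H (V - Z) K"
          have large: "3 / 8 * n \<le> real (card (\<Gamma> A))" if A: "A \<subseteq> V - Z" "\<gamma> * n \<le> card A" for A
          proof -
            have \<Gamma>V: "\<Gamma> A \<subseteq> V - Z" unfolding \<Gamma>_def by (rule robust_nbhd_subset)
            define bad where "bad a b \<longleftrightarrow> adj a b \<and> (a \<in> X \<longleftrightarrow> b \<in> X)" for a b
            have finA: "finite A" "finite Z" using A ZV basic(1) finite_subset by blast+
            have "edge_count adj A (V - \<Gamma> A) \<le> edge_count adj V Z + edge_count adj A (V - Z - \<Gamma> A)"
              by (rule edge_count_cover_le) (use A finA basic(1) in auto)
            also have "edge_count adj V Z = edge_count adj Z V" by (rule edge_count_commute[OF basic(2)])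
            also have "edge_count adj A (V - Z - \<Gamma> A) \<le> edge_count H A (V - Z - \<Gamma> A) + edge_count bad V V"
              by (rule edge_count_cover_le) (use A finA basic(1) in \<open>auto simp: H_def bad_def\<close>)
            also have "edge_count bad V V \<le> edge_count adj X X + edge_count adj (V - X) (V - X)"
              by (rule edge_count_cover_le) (use X basic(1) finite_subset in \<open>auto simp: bad_def\<close>)
            also have "edge_count H A (V - Z - \<Gamma> A) \<le> K * card (V - Z)"
              by (rule edge_count_outside_robust_nbhd) (use basic(1) symH A in \<open>auto simp: \<Gamma>_def\<close>)
            also have "\<dots> \<le> K * n" using V(2) basic(1) by (auto intro!: card_mono)
            finally have "real (edge_count adj A (V - \<Gamma> A)) \<le> edge_count adj Z V + (real K * n + inner_edges adj V X)"
              by (simp add: inner_edges_def flip: of_nat_mult of_nat_add)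
            also have "\<dots> \<le> \<kappa> * n powr \<alpha> + (\<kappa> * n powr \<alpha> + \<kappa> * n powr \<alpha>)"
              using Zedges inner elim(1) elim(2) by (intro add_mono) auto
            also have "\<dots> \<le> \<kappa>' * n powr \<alpha>" using \<kappa>'(1) by (simp add: \<kappa>_def)
            finally show ?thesis using elim(4)[rule_format, of V adj A "\<Gamma> A"] V A \<Gamma>V by auto
          qed
          have \<gamma>n: "\<gamma> * n \<le> 3 / 8 * n" "\<gamma> * n \<le> \<gamma>\<^sub>1 * n" using \<gamma> by (intro mult_right_mono; simp)+
          have LL: "L i \<subseteq> V - Z" "\<gamma> * n \<le> card (L i)" if "i \<in> {u, v}" for i
            using MLV[OF that] L that \<gamma>n by auto
          have iter: "3 / 8 * n \<le> card ((\<Gamma> ^^ s) (L i))" if "i \<in> {u, v}" "0 < s" for i s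
            unfolding \<Gamma>_def by (rule robust_iterate_large[where a = "\<gamma> * n"]) (use large \<gamma>n LL that in \<open>auto simp: \<Gamma>_def\<close>)
          have iterV: "(\<Gamma> ^^ s) (L i) \<subseteq> V" if "i \<in> {u, v}" for i s
            using robust_iterate_mono(2)[where V = "V - Z" and A = "L i" and B = "L i" and adj = H and K = K and t = s] LL(1)[OF that] basic(1) by (auto simp: \<Gamma>_def)
          \<comment> \<open>Tree paths have r + 1 crossing edges and the roots u and v lie on the
            same side, so the leaves of both trees share a side.\<close>
          have side0: "z \<in> X \<longleftrightarrow> (u \<in> X \<longleftrightarrow> odd r)" if iz: "i \<in> {u, v}" "z \<in> L i" for i z
          proof -
            obtain p where "length p = Suc r" "successively H (p @ [z])" "hd (p @ [z]) = i"
              using disjoint_trees_path[OF T iz] by metis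
            then have "z \<in> X \<longleftrightarrow> (i \<in> X \<longleftrightarrow> odd r)" using alternating_side[of H "p @ [z]" X] H(2) by auto
            then show ?thesis using iz(1) same by auto
          qed
          have side: "z \<in> X \<longleftrightarrow> ((u \<in> X \<longleftrightarrow> odd r) \<longleftrightarrow> even s)" if "i \<in> {u, v}" "z \<in> (\<Gamma> ^^ s) (L i)" for i s z
            by (rule robust_iterate_side[OF H(2), where K = K and V = "V - Z" and S = "L i"])
              (use side0 that in \<open>auto simp: \<Gamma>_def K_def\<close>)
          let ?A = "(\<Gamma> ^^ t) (L u)" and ?B = "(\<Gamma> ^^ t) (L v)" and ?C = "(\<Gamma> ^^ Suc t) (L u)"
          have "?A \<inter> ?B \<noteq> {}"
          proof
            assume disj: "?A \<inter> ?B = {}"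
            have fin: "finite ?A" "finite ?B" "finite ?C"
              using iterV basic(1) finite_subset by blast+
            have "?C \<inter> (?A \<union> ?B) = {}" using side[of u _ "Suc t"] side[of u _ t] side[of v _ t] by auto
            then have "card (?C \<union> (?A \<union> ?B)) = card ?C + (card ?A + card ?B)"
              using fin disj by (simp add: card_Un_disjoint)
            moreover have "card (?C \<union> (?A \<union> ?B)) \<le> card V"
              using iterV[of u t] iterV[of v t] iterV[of u "Suc t"] basic(1) by (intro card_mono) auto
            ultimately show False using iter[of u t] iter[of v t] iter[of u "Suc t"] t(2) V(2) elim(2) by auto
          qed
          then obtain w where w: "w \<in> ?A" "w \<in> ?B" by blast
          have "has_cycle adj V (2 * Suc r + t + t + 1 + length ([] :: 'a list))"
            by (rule has_cycle_of_disjoint_trees[OF basic(1,2) T, where adj' = H and K = K and x = u and y = v and w = w])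
              (use H(1) w \<open>u \<noteq> v\<close> uv basic(2) t in \<open>auto simp: \<Gamma>_def Z_def K_def symp_def\<close>)
          then show False using no_cycle t(1) by simp
        qed
        then show "\<exists>X\<subseteq>V. \<forall>u\<in>V. \<forall>v\<in>V. adj u v \<longrightarrow> (u \<in> X \<longleftrightarrow> v \<notin> X)" using X(1) by blast
      qed
    qed
  qed
  then show ?thesis using \<kappa> by blast
qed

end

section \<open>The case far from bipartite\<close>

lemma robust_nbhd_restrict:
  assumes "0 < K" "\<And>u v. adj' u v \<Longrightarrow> u \<notin> Z"
  shows "robust_nbhd adj' V K = robust_nbhd adj' (V - Z) K"
proof
  fix A
  have "v \<notin> Z" if "K \<le> card {a \<in> A. adj' v a}" for v
  proof
    assume "v \<in> Z"
    then have "{a \<in> A. adj' v a} = {}" using assms(2) by blast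
    then show False using that assms(1) by (metis card.empty not_le)
  qed
  then show "robust_nbhd adj' V K A = robust_nbhd adj' (V - Z) K A"
    by (auto simp: robust_nbhd_def)
qed

lemma three_subsets_meet:
  assumes "finite V" "card I = 3" "\<And>i. i \<in> I \<Longrightarrow> W i \<subseteq> V" "\<And>i. i \<in> I \<Longrightarrow> 3 / 8 * card V \<le> real (card (W i))" "0 < card V"
  shows "\<exists>x\<in>I. \<exists>y\<in>I. x \<noteq> y \<and> W x \<inter> W y \<noteq> {}"
proof (rule ccontr)
  assume neg: "\<not> ?thesis"
  have finI: "finite I" using assms(2) card.infinite by fastforce
  have "finite (W i)" if "i \<in> I" for i using assms(1,3) that finite_subset by metis
  then have "card (\<Union>i\<in>I. W i) = (\<Sum>i\<in>I. card (W i))"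
    using neg finI by (intro card_UN_disjoint) auto
  moreover have "card (\<Union>i\<in>I. W i) \<le> card V" by (rule card_mono) (use assms in auto)
  moreover have "card I * (3 / 8 * card V) \<le> (\<Sum>i\<in>I. real (card (W i)))"
    by (rule sum_bounded_below) (use assms in auto)
  ultimately show False using assms(2,5) by (simp flip: of_nat_sum)
qed

context density_bound
begin

text \<open>The roots are three neighbours of a vertex \<open>u\<close>, so any two are linked
  through \<open>u\<close>. This link has even length, and the odd parity comes from
  \<open>robust_dichotomy\<close>: a common vertex of two sets \<open>W i\<close> is joined to one
  tree in t steps and to the other in t + 1. In the other alternative of the dichotomy,
  \<open>P\<close> is the required side of a cut.\<close>

lemma near_bipartite_if_no_cycle:
  fixes \<kappa> :: real
  assumes \<kappa>: "0 < \<kappa>"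
  shows "\<exists>k\<^sub>0. \<forall>k\<ge>k\<^sub>0. odd k \<longrightarrow> (\<forall>\<^sub>F n in sequentially. \<forall>(V :: 'a set) (adj :: 'a \<Rightarrow> 'a \<Rightarrow> bool).
    thin V adj \<and> card V = n \<and> high_degree V adj \<and> \<not> has_cycle adj V k \<longrightarrow>
    (\<exists>X\<subseteq>V. real (inner_edges adj V X) \<le> \<kappa> * n powr \<alpha>))"
proof -
  define c where "c = \<rho> * (2 / 5) powr (\<alpha> - 1)"
  have c: "0 < c" using \<rho> by (simp add: c_def)
  obtain r and \<gamma>\<^sub>1 :: real where trees: "0 < \<gamma>\<^sub>1" "\<And>\<mu>::real. 0 < \<mu> \<Longrightarrow>
    (\<forall>\<^sub>F n in sequentially. \<forall>(V :: 'a set) (adj :: 'a \<Rightarrow> 'a \<Rightarrow> bool).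
    thin V adj \<and> card V = n \<and> (\<forall>v\<in>V. c * n powr (\<alpha> - 1) \<le> card {w \<in> V. adj v w}) \<longrightarrow>
    (\<forall>I U. I \<subseteq> V - U \<longrightarrow> U \<subseteq> V \<longrightarrow> card I \<le> 3 \<longrightarrow> card U \<le> 1 \<longrightarrow>
      (\<exists>M L. disjoint_trees adj V U I (Suc r) M L \<and> (\<forall>i\<in>I. \<gamma>\<^sub>1 * n \<le> card (L i)) \<and> card (\<Union>i\<in>I. M i) \<le> \<mu> * n)))"
    using disjoint_trees_exist[OF c, where ?'a = 'a] by blast
  obtain \<gamma>\<^sub>0 :: real where \<gamma>\<^sub>0: "0 < \<gamma>\<^sub>0" "\<And>\<gamma>::real. 0 < \<gamma> \<and> \<gamma> \<le> \<gamma>\<^sub>0 \<Longrightarrow>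
    (\<exists>\<kappa>::real. \<kappa> > 0 \<and> (\<forall>\<^sub>F n in sequentially. \<forall>(V :: 'a set) (adj :: 'a \<Rightarrow> 'a \<Rightarrow> bool).
    thin V adj \<and> card V = n \<and> high_degree V adj \<longrightarrow>
    (\<forall>A B. A \<subseteq> V \<longrightarrow> B \<subseteq> V \<longrightarrow> \<gamma> * n \<le> card A \<longrightarrow> real (edge_count adj A (V - B)) \<le> \<kappa> * n powr \<alpha> \<longrightarrow>
      3 / 8 * n \<le> real (card B))))"
    using expansion[where ?'a = 'a] by blast
  have "0 < \<kappa> / 8" using \<kappa> by simp
  then obtain \<mu>\<^sub>2 :: real where \<mu>\<^sub>2: "0 < \<mu>\<^sub>2" "\<forall>\<^sub>F n in sequentially. \<forall>(V :: 'a set) (adj :: 'a \<Rightarrow> 'a \<Rightarrow> bool).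
    thin V adj \<and> card V = n \<longrightarrow>
    (\<forall>M\<subseteq>V. card M \<le> \<mu>\<^sub>2 * n \<longrightarrow> real (edge_count adj M V) \<le> \<kappa> / 8 * n powr \<alpha>)"
    using small_set[where ?'a = 'a] by blast
  \<comment> \<open>The entry \<open>\<mu>\<^sub>2 / 7\<close> ensures that the at most 7\<gamma>n
    vertices outside \<open>P\<close> and \<open>Q\<close> meet few edges.\<close>
  define \<gamma> where "\<gamma> = min (min \<gamma>\<^sub>1 \<gamma>\<^sub>0) (min (1 / 100) (\<mu>\<^sub>2 / 7))"
  have \<gamma>: "0 < \<gamma>" "\<gamma> \<le> \<gamma>\<^sub>0" "\<gamma> \<le> \<gamma>\<^sub>1" "\<gamma> \<le> 1 / 100" "7 * \<gamma> \<le> \<mu>\<^sub>2"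
    using trees(1) \<gamma>\<^sub>0(1) \<mu>\<^sub>2(1) by (auto simp: \<gamma>_def)
  obtain \<kappa>' :: real where \<kappa>': "0 < \<kappa>'" "\<forall>\<^sub>F n in sequentially. \<forall>(V :: 'a set) (adj :: 'a \<Rightarrow> 'a \<Rightarrow> bool).
    thin V adj \<and> card V = n \<and> high_degree V adj \<longrightarrow>
    (\<forall>A B. A \<subseteq> V \<longrightarrow> B \<subseteq> V \<longrightarrow> \<gamma> * n \<le> card A \<longrightarrow> real (edge_count adj A (V - B)) \<le> \<kappa>' * n powr \<alpha> \<longrightarrow>
      3 / 8 * n \<le> real (card B))"
    using \<gamma>\<^sub>0(2)[of \<gamma>] \<gamma> by blast
  \<comment> \<open>The share \<kappa>/8 yields 6\<epsilon> + \<kappa>/4 \<le> \<kappa> in the final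
    count. The share \<kappa>'/4 lets 2 K n missed edges and the edges at \<open>Z\<close>, together
    at most 4\<epsilon>n^\<alpha>, pass through \<open>expansion\<close>.\<close>
  define \<epsilon> where "\<epsilon> = min (\<kappa> / 8) (\<kappa>' / 4)"
  have \<epsilon>: "0 < \<epsilon>" "8 * \<epsilon> \<le> \<kappa>" "4 * \<epsilon> \<le> \<kappa>'" using \<kappa> \<kappa>' by (auto simp: \<epsilon>_def)
  obtain \<mu> :: real where \<mu>: "0 < \<mu>" "\<forall>\<^sub>F n in sequentially. \<forall>(V :: 'a set) (adj :: 'a \<Rightarrow> 'a \<Rightarrow> bool).
    thin V adj \<and> card V = n \<longrightarrow>
    (\<forall>M\<subseteq>V. card M \<le> \<mu> * n \<longrightarrow> real (edge_count adj M V) \<le> \<epsilon> * n powr \<alpha>)"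
    using small_set[OF \<epsilon>(1), where ?'a = 'a] by blast
  obtain J :: nat where J: "1 / \<gamma> \<le> J" using real_arch_simple by blast
  have "\<forall>\<^sub>F n in sequentially. \<forall>(V :: 'a set) (adj :: 'a \<Rightarrow> 'a \<Rightarrow> bool).
    thin V adj \<and> card V = n \<and> high_degree V adj \<and> \<not> has_cycle adj V k \<longrightarrow>
    (\<exists>X\<subseteq>V. real (inner_edges adj V X) \<le> \<kappa> * n powr \<alpha>)"
    if k: "k \<ge> 2 * Suc r + 2 * (2 * J + 4) + 3" "odd k" for k
  proof -
    \<comment> \<open>Robust paths of t and t + 1 steps, with the meeting vertex and
      \<open>u\<close>, give total length k; the lower bound on k brings t into the range of the
      dichotomy.\<close>
    define t where "t = (k - 2 * Suc r - 3) div 2"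
    have t: "k = 2 * Suc r + t + Suc t + 1 + 1" "2 * J + 4 \<le> t" using k unfolding t_def by presburger+
    define K where "K = k + 1"
    have half_pos: "\<mu> / 2 > 0" using \<mu> by simp
    have "\<forall>\<^sub>F n in sequentially. real K * real n powr 1 \<le> \<epsilon> * real n powr \<alpha>"
      using exps \<epsilon> by (intro eventually_powr_le) auto
    \<comment> \<open>Constants appear as multiples of n^0 to suit
      \<open>eventually_powr_le\<close>. This bound makes room for \<open>u\<close> in
      \<open>Z\<close>, the next one provides three neighbours of \<open>u\<close>.\<close>
    moreover have "\<forall>\<^sub>F n in sequentially. 1 * real n powr 0 \<le> \<mu> / 2 * real n powr 1"
      using \<mu> by (intro eventually_powr_le) auto
    moreover have "\<forall>\<^sub>F n in sequentially. 3 * real n powr 0 \<le> c * real n powr (\<alpha> - 1)"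
      using exps c by (intro eventually_powr_le) auto
    moreover have "\<forall>\<^sub>F n in sequentially. n > (0::nat)" by (rule eventually_gt_at_top)
    ultimately show ?thesis using trees(2)[OF half_pos] \<kappa>'(2) \<mu>(2) \<mu>\<^sub>2(2)
    proof eventually_elim
      case (elim n)
      show ?case
      proof (intro allI impI, elim conjE)
        fix V :: "'a set" and adj :: "'a \<Rightarrow> 'a \<Rightarrow> bool"
        assume V: "thin V adj" "card V = n" "high_degree V adj" and no_cycle: "\<not> has_cycle adj V k"
        note basic = thinD[OF V(1)]
        have deg: "c * n powr (\<alpha> - 1) \<le> card {w \<in> V. adj a w}" if "a \<in> V" for a
        proof -
          have "\<rho> * (2 / 5 * n) powr (\<alpha> - 1) \<le> card {w \<in> V. adj a w}"
            using V that by (auto simp: high_degree_def)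
          then show ?thesis by (simp only: powr_mult) (simp add: c_def powr_mult)
        qed
        obtain u where u: "u \<in> V" using V(2) elim(4) by (metis card.empty ex_in_conv less_irrefl)
        have "3 \<le> real (card {w \<in> V. adj u w})" using deg[OF u] elim(3,4) by simp
        then have "3 \<le> card {w \<in> V. adj u w}" by linarith
        then obtain I where I: "I \<subseteq> {w \<in> V. adj u w}" "card I = 3"
          using obtain_subset_with_card_n by metis
        have IV: "I \<subseteq> V - {u}" using I basic(3) by (auto simp: irreflp_def)
        obtain M L where T: "disjoint_trees adj V {u} I (Suc r) M L"
          and L: "\<forall>i\<in>I. \<gamma>\<^sub>1 * n \<le> card (L i)" and M: "card (\<Union>i\<in>I. M i) \<le> \<mu> / 2 * n"
          using elim(5)[rule_format, of V adj I "{u}"] V deg IV I(2) u by auto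
        define Z where "Z = {u} \<union> (\<Union>i\<in>I. M i)"
        have MLV: "M i \<subseteq> V" "L i \<subseteq> V" if "i \<in> I" for i
          using T that unfolding disjoint_trees_def by blast+
        have ZV: "Z \<subseteq> V" using MLV u by (auto simp: Z_def)
        have "card Z \<le> 1 + card (\<Union>i\<in>I. M i)" unfolding Z_def using card_Un_le[of "{u}"] by fastforce
        then have "card Z \<le> \<mu> * n" using M elim(2,4) by simp
        then have Zedges: "real (edge_count adj Z V) \<le> \<epsilon> * n powr \<alpha>" using elim(7) V ZV by auto
        \<comment> \<open>The edges at \<open>u\<close> and at tree vertices are deleted while
          \<open>V\<close> is kept, so that the dichotomy measures densities against all n
          vertices.\<close>
        define adj' where "adj' a b \<longleftrightarrow> adj a b \<and> a \<notin> Z \<and> b \<notin> Z" for a b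
        have adj': "adj a b" "a \<notin> Z" if "adj' a b" for a b using that by (auto simp: adj'_def)
        have sym': "symp adj'" using basic(2) by (auto simp: adj'_def symp_def)
        have restrict: "real (edge_count adj A B) \<le> edge_count adj' A B + 2 * \<epsilon> * n powr \<alpha>"
          if "A \<subseteq> V" "B \<subseteq> V" for A B
        proof -
          have fin: "finite A" "finite B" "finite Z" using that ZV basic(1) finite_subset by blast+
          have "edge_count adj A B \<le> edge_count adj' A B + edge_count (\<lambda>a b. adj a b \<and> (a \<in> Z \<or> b \<in> Z)) A B"
            by (rule edge_count_cover_le) (use fin in \<open>auto simp: adj'_def\<close>)
          also have "edge_count (\<lambda>a b. adj a b \<and> (a \<in> Z \<or> b \<in> Z)) A B \<le> edge_count adj Z V + edge_count adj V Z"
            by (rule edge_count_cover_le) (use fin basic(1) that in auto)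
          also have "edge_count adj V Z = edge_count adj Z V" by (rule edge_count_commute[OF basic(2)])
          finally show ?thesis using Zedges by simp
        qed
        have "real K * n \<le> \<epsilon> * n powr \<alpha>" using elim(1,4) by simp
        then have Kn: "real (2 * K * n) \<le> 2 * \<epsilon> * n powr \<alpha>" by simp
        have expand: "3 / 8 * n \<le> real (card B)"
          if "A \<subseteq> V" "B \<subseteq> V" "\<gamma> * n \<le> card A" "edge_count adj' A (V - B) \<le> 2 * K * n" for A B
        proof -
          have "real (edge_count adj' A (V - B)) \<le> real (2 * K * n)" using that(4) by (simp only: of_nat_le_iff)
          then have "real (edge_count adj A (V - B)) \<le> 4 * \<epsilon> * n powr \<alpha>"
            using restrict[of A "V - B"] that(1) Kn by auto
          also have "\<dots> \<le> \<kappa>' * n powr \<alpha>" using \<epsilon> by (intro mult_right_mono) auto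
          finally show ?thesis using elim(6)[rule_format, of V adj A B] V that by auto
        qed
        define \<Gamma> where "\<Gamma> = robust_nbhd adj' V K"
        have dich: "(\<forall>t\<ge>2 * J + 4. 3 / 8 * n \<le> real (card ((\<Gamma> ^^ t) (L i) \<inter> (\<Gamma> ^^ Suc t) (L i)))) \<or>
          (\<exists>P Q. P \<subseteq> V \<and> Q \<subseteq> V \<and> P \<inter> Q = {} \<and> card (V - (P \<union> Q)) \<le> 7 * \<gamma> * n \<and>
            edge_count adj' P P \<le> K * n \<and> edge_count adj' Q Q \<le> K * n)" if "i \<in> I" for i
        proof -
          have "\<gamma> * n \<le> \<gamma>\<^sub>1 * n" using \<gamma>(3) by (intro mult_right_mono) auto
          then have "\<gamma> * n \<le> card (L i)" using L that by fastforce
          then show ?thesis unfolding \<Gamma>_def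
            by (intro robust_dichotomy basic(1) V(2) elim(4) sym' \<gamma>(1) \<gamma>(4) expand MLV(2) that J)
        qed
        show "\<exists>X\<subseteq>V. real (inner_edges adj V X) \<le> \<kappa> * n powr \<alpha>"
        proof (cases "\<exists>P Q. P \<subseteq> V \<and> Q \<subseteq> V \<and> P \<inter> Q = {} \<and> card (V - (P \<union> Q)) \<le> 7 * \<gamma> * n \<and>
            edge_count adj' P P \<le> K * n \<and> edge_count adj' Q Q \<le> K * n")
          case True
          then obtain P Q where PQ: "P \<subseteq> V" "Q \<subseteq> V" "card (V - (P \<union> Q)) \<le> 7 * \<gamma> * n"
            "edge_count adj' P P \<le> K * n" "edge_count adj' Q Q \<le> K * n" by blast
          define R where "R = V - (P \<union> Q)"
          have "7 * \<gamma> * n \<le> \<mu>\<^sub>2 * n" using \<gamma>(5) by (intro mult_right_mono) auto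
          then have "card R \<le> \<mu>\<^sub>2 * n" using PQ(3) by (simp add: R_def)
          then have R: "real (edge_count adj R V) \<le> \<kappa> / 8 * n powr \<alpha>"
            using elim(8)[rule_format, of V adj R] V by (auto simp: R_def)
          have fin: "finite P" "finite Q" "finite R" using PQ basic(1) finite_subset by (auto simp: R_def)
          \<comment> \<open>An edge inside V - P lies inside \<open>Q\<close> or has an end in the
            small set \<open>R\<close>.\<close>
          have "edge_count adj (V - P) (V - P) \<le> edge_count adj Q Q +
            edge_count (\<lambda>a b. adj a b \<and> (a \<in> R \<or> b \<in> R)) V V"
            by (rule edge_count_cover_le) (use fin basic(1) in \<open>auto simp: R_def\<close>)
          also have "edge_count (\<lambda>a b. adj a b \<and> (a \<in> R \<or> b \<in> R)) V V \<le> edge_count adj R V + edge_count adj V R"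
            by (rule edge_count_cover_le) (use fin basic(1) in auto)
          also have "edge_count adj V R = edge_count adj R V" by (rule edge_count_commute[OF basic(2)])
          finally have "real (inner_edges adj V P) \<le> edge_count adj P P + edge_count adj Q Q + 2 * real (edge_count adj R V)"
            by (simp add: inner_edges_def)
          also have "\<dots> \<le> (edge_count adj' P P + 2 * \<epsilon> * n powr \<alpha>) + (edge_count adj' Q Q + 2 * \<epsilon> * n powr \<alpha>) +
            2 * (\<kappa> / 8 * n powr \<alpha>)"
            using restrict[OF PQ(1,1)] restrict[OF PQ(2,2)] R by linarith
          also have "\<dots> \<le> 6 * \<epsilon> * n powr \<alpha> + \<kappa> / 4 * n powr \<alpha>"
          proof -
            have "real (edge_count adj' P P) \<le> real (K * n)" "real (edge_count adj' Q Q) \<le> real (K * n)"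
              using PQ by (simp_all only: of_nat_le_iff)
            then show ?thesis using Kn by simp
          qed
          also have "\<dots> = (6 * \<epsilon> + \<kappa> / 4) * n powr \<alpha>" by (simp add: algebra_simps)
          also have "\<dots> \<le> \<kappa> * n powr \<alpha>" using \<epsilon> by (intro mult_right_mono) auto
          finally show ?thesis using PQ(1) by blast
        next
          case False
          define W where "W i = (\<Gamma> ^^ t) (L i) \<inter> (\<Gamma> ^^ Suc t) (L i)" for i
          have "3 / 8 * n \<le> real (card (W i))" if "i \<in> I" for i
            using dich[OF that] False t(2) unfolding W_def by blast
          moreover have "W i \<subseteq> V" for i
            using robust_nbhd_subset[of adj' V K] by (auto simp: W_def \<Gamma>_def)
          ultimately have "\<exists>x\<in>I. \<exists>y\<in>I. x \<noteq> y \<and> W x \<inter> W y \<noteq> {}"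
            using I(2) V(2) elim(4) by (intro three_subsets_meet[OF basic(1)]) auto
          then obtain x y w where xy: "x \<in> I" "y \<in> I" "x \<noteq> y" and w: "w \<in> W x" "w \<in> W y"
            by blast
          \<comment> \<open>The dichotomy iterates in \<open>V\<close>, the cycle lemma off
            \<open>Z\<close>. The operators agree, since vertices of \<open>Z\<close> have no
            \<open>adj'\<close>-neighbours and K > 0.\<close>
          have \<Gamma>': "robust_nbhd adj' (V - ({u} \<union> (\<Union>i\<in>I. M i))) K = \<Gamma>"
            unfolding \<Gamma>_def by (rule robust_nbhd_restrict[symmetric]) (use adj' in \<open>auto simp: K_def Z_def\<close>)
          have "has_cycle adj V (2 * Suc r + t + Suc t + 1 + length [u])"
          proof (rule has_cycle_of_disjoint_trees[OF basic(1,2) T, where adj' = adj' and K = K and x = x and y = y and w = w])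
            show "successively adj (y # [u] @ [x])" using xy I(1) basic(2) by (auto simp: symp_def)
            show "w \<in> (robust_nbhd adj' (V - ({u} \<union> (\<Union>i\<in>I. M i))) K ^^ t) (L x)"
              "w \<in> (robust_nbhd adj' (V - ({u} \<union> (\<Union>i\<in>I. M i))) K ^^ Suc t) (L y)"
              using w unfolding \<Gamma>' W_def by blast+
          qed (use adj'(1) xy u t(1) in \<open>auto simp: K_def\<close>)
          then show ?thesis using no_cycle t(1) by simp
        qed
      qed
    qed
  qed
  then show ?thesis by blast
qed

text \<open>The tolerance \<kappa> comes from \<open>bipartite_if_near_bipartite\<close> and is then
  met by \<open>near_bipartite_if_no_cycle\<close>.\<close>

lemma bipartite_if_no_odd_cycle:
  "\<exists>k\<^sub>0. \<forall>k\<ge>k\<^sub>0. odd k \<longrightarrow> (\<forall>\<^sub>F n in sequentially. \<forall>(V :: 'a set) (adj :: 'a \<Rightarrow> 'a \<Rightarrow> bool).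
    thin V adj \<and> card V = n \<and> high_degree V adj \<and> \<not> has_cycle adj V k \<longrightarrow>
    (\<exists>X\<subseteq>V. \<forall>u\<in>V. \<forall>v\<in>V. adj u v \<longrightarrow> (u \<in> X \<longleftrightarrow> v \<notin> X)))"
proof -
  obtain \<kappa> :: real and k1 where \<kappa>: "0 < \<kappa>" and k1: "\<And>k. k \<ge> k1 \<Longrightarrow> odd k \<Longrightarrow> (\<forall>\<^sub>F n in sequentially. \<forall>(V :: 'a set) (adj :: 'a \<Rightarrow> 'a \<Rightarrow> bool).
    thin V adj \<and> card V = n \<and> high_degree V adj \<and> \<not> has_cycle adj V k \<and>
    (\<exists>X\<subseteq>V. real (inner_edges adj V X) \<le> \<kappa> * n powr \<alpha>) \<longrightarrow>
    (\<exists>X\<subseteq>V. \<forall>u\<in>V. \<forall>v\<in>V. adj u v \<longrightarrow> (u \<in> X \<longleftrightarrow> v \<notin> X)))"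
    using bipartite_if_near_bipartite[where ?'a = 'a] by blast
  obtain k2 where k2: "\<And>k. k \<ge> k2 \<Longrightarrow> odd k \<Longrightarrow> (\<forall>\<^sub>F n in sequentially. \<forall>(V :: 'a set) (adj :: 'a \<Rightarrow> 'a \<Rightarrow> bool).
    thin V adj \<and> card V = n \<and> high_degree V adj \<and> \<not> has_cycle adj V k \<longrightarrow>
    (\<exists>X\<subseteq>V. real (inner_edges adj V X) \<le> \<kappa> * n powr \<alpha>))"
    using near_bipartite_if_no_cycle[OF \<kappa>, where ?'a = 'a] by blast
  show ?thesis
  proof (intro exI[of _ "max k1 k2"] allI impI)
    fix k assume "max k1 k2 \<le> k" "odd k"
    then have "k1 \<le> k" "k2 \<le> k" by auto
    from k1[OF this(1) \<open>odd k\<close>] k2[OF this(2) \<open>odd k\<close>]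
    show "\<forall>\<^sub>F n in sequentially. \<forall>(V :: 'a set) (adj :: 'a \<Rightarrow> 'a \<Rightarrow> bool).
      thin V adj \<and> card V = n \<and> high_degree V adj \<and> \<not> has_cycle adj V k \<longrightarrow>
      (\<exists>X\<subseteq>V. \<forall>u\<in>V. \<forall>v\<in>V. adj u v \<longrightarrow> (u \<in> X \<longleftrightarrow> v \<notin> X))"
    proof eventually_elim
      case (elim n)
      show ?case
      proof (intro allI impI)
        fix V :: "'a set" and adj :: "'a \<Rightarrow> 'a \<Rightarrow> bool"
        assume *: "thin V adj \<and> card V = n \<and> high_degree V adj \<and> \<not> has_cycle adj V k"
        with elim(2) have "\<exists>X\<subseteq>V. real (inner_edges adj V X) \<le> \<kappa> * n powr \<alpha>" by simp
        with * show "\<exists>X\<subseteq>V. \<forall>u\<in>V. \<forall>v\<in>V. adj u v \<longrightarrow> (u \<in> X \<longleftrightarrow> v \<notin> X)"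
          by (intro elim(1)[THEN spec, THEN spec, THEN mp] conjI) simp_all
      qed
    qed
  qed
qed

end

section \<open>Graphs\<close>

definition adjacent :: "'a graph \<Rightarrow> 'a \<Rightarrow> 'a \<Rightarrow> bool" where
  "adjacent G u v \<longleftrightarrow> {u, v} \<in> edges G"

lemma adjacentD:
  assumes "simple_graph G" "adjacent G u v"
  shows "u \<in> verts G" "v \<in> verts G" "u \<noteq> v"
proof -
  have "{u, v} \<subseteq> verts G" "card {u, v} = 2" using assms by (auto simp: simple_graph_def adjacent_def)
  then show "u \<in> verts G" "v \<in> verts G" "u \<noteq> v" by auto
qed

lemma symp_adjacent: "symp (adjacent G)"
  by (auto simp: symp_def adjacent_def insert_commute)

lemma degree_eq_card_adjacent:
  assumes "simple_graph G"
  shows "degree G v = card {w \<in> verts G. adjacent G v w}"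
proof -
  have "e \<in> (\<lambda>w. {v, w}) ` {w \<in> verts G. adjacent G v w}" if e: "e \<in> edges G" "v \<in> e" for e
  proof -
    have "card e = 2" using assms e by (auto simp: simple_graph_def)
    then obtain a b where "e = {a, b}" by (auto simp: card_2_iff)
    then obtain w where "e = {v, w}" using e(2) by (auto simp: insert_commute)
    then show ?thesis using e(1) adjacentD(2)[OF assms, of v w] by (auto simp: adjacent_def)
  qed
  then have "{e \<in> edges G. v \<in> e} = (\<lambda>w. {v, w}) ` {w \<in> verts G. adjacent G v w}"
    by (intro equalityI subsetI) (auto simp: adjacent_def)
  moreover have "inj_on (\<lambda>w. {v, w}) {w \<in> verts G. adjacent G v w}"
    by (auto simp: inj_on_def doubleton_eq_iff)
  ultimately show ?thesis unfolding degree_def by (simp add: card_image)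
qed

lemma bipartite_subgraph_edges:
  assumes G: "simple_graph G" and AB: "A \<subseteq> verts G" "B \<subseteq> verts G" "A \<inter> B = {}"
  defines "H \<equiv> (A \<union> B, {e \<in> edges G. \<exists>a\<in>A. \<exists>b\<in>B. e = {a, b}})"
  shows "simple_graph H" "bipartite_with H A B" "card (edges H) = edge_count (adjacent G) A B"
proof -
  have "finite (A \<union> B)" using G AB finite_subset by (auto simp: simple_graph_def)
  then show "simple_graph H" using G by (auto simp: simple_graph_def H_def)
  show "bipartite_with H A B" using AB by (auto simp: bipartite_with_def H_def)
  have "edges H = (\<lambda>(a, b). {a, b}) ` {(a, b). a \<in> A \<and> b \<in> B \<and> adjacent G a b}"
    by (auto simp: H_def adjacent_def)
  moreover have "inj_on (\<lambda>(a, b). {a, b}) {(a, b). a \<in> A \<and> b \<in> B \<and> adjacent G a b}"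
    using AB by (auto simp: inj_on_def doubleton_eq_iff)
  ultimately show "card (edges H) = edge_count (adjacent G) A B"
    by (simp add: edge_count_def card_image)
qed

text \<open>The edges between \<open>A\<close> and \<open>B\<close> form a bipartite subgraph, which
  is still free of the family and so competes in the maximum.\<close>

lemma edge_count_le_zarankiewicz:
  fixes G :: "nat graph"
  assumes G: "simple_graph G" "family_free \<F> G" and AB: "A \<subseteq> verts G" "B \<subseteq> verts G" "A \<inter> B = {}"
  shows "edge_count (adjacent G) A B \<le> zarankiewicz (card A) (card B) \<F>"
proof -
  define S where "S = {card (edges G) | G :: nat graph. simple_graph G \<and> family_free \<F> G \<and>
     (\<exists>X Y. bipartite_with G X Y \<and> card X = card A \<and> card Y = card B)}"
  \<comment> \<open>A crude bound showing that the set of edge numbers is finite, so that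
    \<open>Max\<close> bounds its members.\<close>
  have "card (edges H) \<le> 2 ^ (card A + card B)"
    if H: "simple_graph H" "bipartite_with H X Y" "card X = card A" "card Y = card B" for H :: "nat graph" and X Y
  proof -
    have fin: "finite (verts H)" and E: "edges H \<subseteq> Pow (verts H)" using H(1) by (auto simp: simple_graph_def)
    have "card (verts H) \<le> card A + card B"
      using card_Un_le[of X Y] H by (simp add: bipartite_with_def)
    then have "2 ^ card (verts H) \<le> (2::nat) ^ (card A + card B)" by (intro power_increasing) auto
    moreover have "card (edges H) \<le> 2 ^ card (verts H)"
      using card_mono[OF _ E] fin by (simp add: card_Pow)
    ultimately show ?thesis by linarith
  qed
  then have "S \<subseteq> {..2 ^ (card A + card B)}" by (auto simp: S_def)
  then have finS: "finite S" by (rule finite_subset) simp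
  define H where "H = (A \<union> B, {e \<in> edges G. \<exists>a\<in>A. \<exists>b\<in>B. e = {a, b}})"
  note H = bipartite_subgraph_edges[OF G(1) AB, folded H_def]
  have "contains_copy G F" if "contains_copy H F" for F :: "nat graph"
  proof -
    have "verts H \<subseteq> verts G" "edges H \<subseteq> edges G" using AB by (auto simp: H_def)
    then show ?thesis using that unfolding contains_copy_def by (meson subset_trans subsetD)
  qed
  then have "family_free \<F> H" using G(2) by (auto simp: family_free_def)
  then have "edge_count (adjacent G) A B \<in> S"
    using H(1,2) unfolding S_def H(3)[symmetric] by blast
  then show ?thesis unfolding zarankiewicz_def S_def[symmetric] using finS by (rule Max_ge[rotated])
qed

lemma contains_copy_cycle_graph:
  assumes "has_cycle (adjacent G) (verts G) k"
  shows "contains_copy G (cycle_graph k)"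
proof -
  obtain p where p: "length p = k" "p \<noteq> []" "distinct p" "set p \<subseteq> verts G" "successively (adjacent G) p"
    "adjacent G (last p) (hd p)" using assms by (auto simp: has_cycle_def)
  have "{p ! i, p ! (Suc i mod k)} \<in> edges G" if "i < k" for i
  proof (cases "Suc i < k")
    case True
    then show ?thesis using p(1,5) by (auto simp: successively_conv_nth adjacent_def)
  next
    case False
    then have "Suc i = k" using that by simp
    then show ?thesis using p(1,2,6) by (auto simp: adjacent_def last_conv_nth hd_conv_nth)
  qed
  moreover have "inj_on ((!) p) {..<k}" using p(1,3) by (auto simp: inj_on_def nth_eq_iff_index_eq)
  moreover have "(!) p ` {..<k} \<subseteq> verts G" using p(1,4) by auto
  ultimately show ?thesis
    unfolding contains_copy_def cycle_graph_def by (intro exI[of _ "(!) p"]) auto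
qed

lemma bipartite_if_cut:
  assumes G: "simple_graph G" and X: "X \<subseteq> verts G"
    "\<forall>u\<in>verts G. \<forall>v\<in>verts G. adjacent G u v \<longrightarrow> (u \<in> X \<longleftrightarrow> v \<notin> X)"
  shows "bipartite G"
proof -
  have "\<exists>x\<in>X. \<exists>y\<in>verts G - X. e = {x, y}" if e: "e \<in> edges G" for e
  proof -
    have "card e = 2" using G e by (auto simp: simple_graph_def)
    then obtain u v where uv: "e = {u, v}" by (auto simp: card_2_iff)
    then have "adjacent G u v" using e by (simp add: adjacent_def)
    then show ?thesis using adjacentD[OF G] X uv by (metis DiffI insert_commute)
  qed
  then have "bipartite_with G X (verts G - X)" using X by (auto simp: bipartite_with_def)
  then show ?thesis by (auto simp: bipartite_def)
qed

theorem theorem1p5: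
  fixes \<alpha> \<beta> \<rho> :: real and \<F> :: "nat graph set"
  assumes "bipartite_family \<F>"
    and "smooth \<alpha> \<beta> \<rho> \<F>"
    and "\<rho> > 0"
  shows "\<exists>k\<^sub>0::nat. \<forall>k\<ge>k\<^sub>0. odd k \<longrightarrow>
    (\<exists>g :: nat \<Rightarrow> real. g \<in> o(\<lambda>n. real n) \<and>
      (\<forall>\<^sub>F n in sequentially. \<forall>G :: nat graph.
        simple_graph G \<and> card (verts G) = n \<and> family_free (\<F> \<union> {cycle_graph k}) G \<and>
        real (min_degree G) \<ge> \<rho> * (2 * real n / 5 + g n) powr (\<alpha> - 1)
        \<longrightarrow> bipartite G))"
proof -
  obtain C\<^sub>0 N where exps: "1 \<le> \<beta>" "\<beta> < \<alpha>" "\<alpha> < 2" and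
    z: "\<And>m n. N \<le> n \<Longrightarrow> m \<le> n \<Longrightarrow>
      \<bar>real (zarankiewicz m n \<F>) - \<rho> * real m * real n powr (\<alpha> - 1)\<bar> \<le> C\<^sub>0 * real n powr \<beta>"
    using assms(2) unfolding smooth_def by blast
  \<comment> \<open>\<open>C\<close> has to be nonnegative and to cover all sizes: below the
    threshold, |A| \<le> |B| < N leaves at most N |B| \<le> N |B|^\<beta> edges, as \<beta> \<ge>
    1.\<close>
  define C where "C = max C\<^sub>0 0 + real N"
  interpret density_bound \<alpha> \<beta> \<rho> C
    by unfold_locales (use exps assms(3) in \<open>auto simp: C_def\<close>)
  have thin: "thin (verts G) (adjacent G)" if G: "simple_graph G" "family_free \<F> G" for G :: "nat graph"
    unfolding thin_def
  proof (intro conjI allI impI)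
    show finG: "finite (verts G)" using G by (simp add: simple_graph_def)
    show "symp (adjacent G)" by (rule symp_adjacent)
    show "irreflp (adjacent G)" using adjacentD(3)[OF G(1)] by (auto simp: irreflp_def)
    fix A B assume AB: "A \<subseteq> verts G" "B \<subseteq> verts G" "A \<inter> B = {}" "card A \<le> card B"
    let ?b = "real (card B)"
    show "real (edge_count (adjacent G) A B) \<le> \<rho> * card A * card B powr (\<alpha> - 1) + C * card B powr \<beta>"
    proof (cases "N \<le> card B")
      case True
      have "real (edge_count (adjacent G) A B) \<le> zarankiewicz (card A) (card B) \<F>"
        using edge_count_le_zarankiewicz[OF G AB(1-3)] by simp
      also have "\<dots> \<le> \<rho> * card A * ?b powr (\<alpha> - 1) + C\<^sub>0 * ?b powr \<beta>"
        using z[OF True AB(4)] by linarith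
      also have "C\<^sub>0 * ?b powr \<beta> \<le> C * ?b powr \<beta>" by (intro mult_right_mono) (auto simp: C_def)
      finally show ?thesis by simp
    next
      case False
      have fin: "finite A" "finite B" using AB finG finite_subset by blast+
      have "edge_count (adjacent G) A B \<le> card A * card B" by (rule edge_count_le_mult[OF fin])
      also have "\<dots> \<le> N * card B" using False AB(4) by (intro mult_right_mono) auto
      finally have "real (edge_count (adjacent G) A B) \<le> real (N * card B)" by (simp only: of_nat_le_iff)
      also have "\<dots> \<le> N * ?b powr \<beta>"
      proof (cases "card B = 0")
        case False
        then have "?b powr 1 \<le> ?b powr \<beta>" using exps by (intro powr_mono) auto
        then show ?thesis using False by (simp add: mult_left_mono)
      qed simp
      also have "\<dots> \<le> C * ?b powr \<beta>" by (intro mult_right_mono) (auto simp: C_def)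
      also have "\<dots> \<le> \<rho> * card A * ?b powr (\<alpha> - 1) + C * ?b powr \<beta>" using assms(3) by simp
      finally show ?thesis .
    qed
  qed
  obtain k\<^sub>0 where k\<^sub>0: "\<And>k. k\<^sub>0 \<le> k \<Longrightarrow> odd k \<Longrightarrow> \<forall>\<^sub>F n in sequentially. \<forall>(V :: nat set) adj.
    thin V adj \<and> card V = n \<and> high_degree V adj \<and> \<not> has_cycle adj V k \<longrightarrow>
    (\<exists>X\<subseteq>V. \<forall>u\<in>V. \<forall>v\<in>V. adj u v \<longrightarrow> (u \<in> X \<longleftrightarrow> v \<notin> X))"
    using bipartite_if_no_odd_cycle[where ?'a = nat] by blast
  have "\<forall>\<^sub>F n in sequentially. \<forall>G :: nat graph.
      simple_graph G \<and> card (verts G) = n \<and> family_free (\<F> \<union> {cycle_graph k}) G \<and>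
      real (min_degree G) \<ge> \<rho> * (2 * real n / 5 + 0) powr (\<alpha> - 1) \<longrightarrow> bipartite G"
    if k: "k\<^sub>0 \<le> k" "odd k" for k
    using k\<^sub>0[OF k]
  proof eventually_elim
    case (elim n)
    show ?case
    proof (intro allI impI, elim conjE)
      fix G :: "nat graph"
      assume G: "simple_graph G" "card (verts G) = n" "family_free (\<F> \<union> {cycle_graph k}) G"
        and min_deg: "\<rho> * (2 * real n / 5 + 0) powr (\<alpha> - 1) \<le> real (min_degree G)"
      have "family_free \<F> G" "\<not> contains_copy G (cycle_graph k)" using G(3) by (auto simp: family_free_def)
      then have "\<not> has_cycle (adjacent G) (verts G) k" "thin (verts G) (adjacent G)"
        using contains_copy_cycle_graph thin G(1) by blast+
      moreover have "high_degree (verts G) (adjacent G)"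
        unfolding high_degree_def
      proof
        fix v assume v: "v \<in> verts G"
        have "min_degree G \<le> degree G v"
          unfolding min_degree_def using v G(1) by (intro Min_le) (auto simp: simple_graph_def)
        then show "\<rho> * (2 * real (card (verts G)) / 5) powr (\<alpha> - 1) \<le> card {w \<in> verts G. adjacent G v w}"
          using min_deg G(2) degree_eq_card_adjacent[OF G(1), of v] by simp
      qed
      ultimately have "\<exists>X\<subseteq>verts G. \<forall>u\<in>verts G. \<forall>v\<in>verts G. adjacent G u v \<longrightarrow> (u \<in> X \<longleftrightarrow> v \<notin> X)"
        using elim G(2) by blast
      then show "bipartite G" using bipartite_if_cut[OF G(1)] by blast
    qed
  qed
  then show ?thesis
    by (intro exI[of _ k\<^sub>0] allI impI exI[of _ "\<lambda>_. 0"] conjI) auto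
qed

end
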